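(* Let $\varphi$, $f$ be as in the context and satisfy (BS), and let $u^N(t,\cdot)$ be the solution of the discrete equation $$\partial_tu^N(t,x)=\Delta^N\varphi(u^N(t,x))+Kf(u^N(t,x)),\qquad x\in\mathbb{T}_N^d,$$ with initial value $u^N(0,\cdot)$ satisfying (BIP1) and (BIP2). Let $\delta\in(0,\delta_0)$ with $\delta_0=\min\{\alpha_*-\alpha_-,\alpha_+-\alpha_*\}$, and let $t^N=\frac1{2\gamma K}\log K$. Suppose that $K=K(N)\uparrow\infty$ and $K(N)=o\big(N^{2\gamma/(3\gamma+\bar\gamma)}\big)$ as $N\to\infty$, where $\gamma=f'(\alpha_* )$ and $-\bar\gamma=\min_{\zeta\in[u_-\wedge\alpha_-,\,u_+\vee\alpha_+]}f'(\zeta)$. Then there exist $N_0,M_0>0$ such that for every $N\ge N_0$: (1) for all $x\in\mathbb{T}_N^d$, $\alpha_--\delta\le u^N(t^N,x)\le\alpha_++\delta$; (2) if $u_0(\frac xN)\ge\alpha_*+M_0K^{-1/2}$, then $u^N(t^N,x)\ge\alpha_+-\delta$; (3) if $u_0(\frac xN)\le\alpha_*-M_0K^{-1/2}$, then $u^N(t^N,x)\le\alpha_-+\delta$.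
   Context: **The functions $\varphi$ and $f$.** $\mathbb{Z}_+=\{0,1,\dots\}$. $g:\mathbb{Z}_+\to[0,\infty)$ with $g(k)=0$ iff $k=0$; $g(0)!=1$, $g(k)!=g(1)\cdots g(k)$; $\varphi^*=\liminf_kg(k)$. For $0\le\varphi<\varphi^*$ let $\bar\nu_\varphi$ be the product measure on $\mathbb{Z}_+^{\mathbb{Z}^d}$ with marginal $\bar\nu_\varphi(k)=Z_\varphi^{-1}\varphi^k/g(k)!$; it is assumed that its mean $\rho(\varphi)$ diverges as $\varphi\uparrow\varphi^*$. $\varphi=\varphi(\rho)$, $\rho\ge0$, is the inverse of $\rho(\varphi)$, and $\nu_\rho=\bar\nu_{\varphi(\rho)}$, so $\varphi(\rho)=E_{\nu_\rho}[g(\eta_0)]$. Given nonnegative local functions $c^\pm$ on $\mathbb{Z}_+^{\mathbb{Z}^d}$ (with $c^-(\eta)=0$ if $\eta_0=0$), $f(\rho)=E_{\nu_\rho}[c^+]-E_{\nu_\rho}[c^-]$. It is known that $\varphi,f\in C^\infty(\mathbb{R}_+)$ and $\varphi'(\rho)>0$ for $\rho>0$; also $f(0)>0$. (BS) $f$ has exactly three zeros $0<\alpha_-<\alpha_*<\alpha_+$, with $f'(\alpha_-)<0$, $f'(\alpha_* )>0$, $f'(\alpha_+)<0$, and $\int_{\alpha_-}^{\alpha_+}f(\rho)\varphi'(\rho)\,d\rho=0$. **Discrete setting.** $d\ge2$, $\mathbb{T}_N^d=(\mathbb{Z}/N\mathbb{Z})^d$, $\mathbb{T}^d=(\mathbb{R}/\mathbb{Z})^d$,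 $e_i$ standard unit vectors, and $$\Delta^N\varphi(u(x))=N^2\sum_{i=1}^d\{\varphi(u(x+e_i))+\varphi(u(x-e_i))-2\varphi(u(x))\}.$$ **Initial data.** (BIP1) $u_-\le u^N(0,x)\le u_+$ for some $0<u_-<u_+$ (independent of $N$, $x$). (BIP2) $u^N(0,x)=u_0(x/N)$ with $u_0\in C^5(\mathbb{T}^d)$; $\Gamma_0=\{v:u_0(v)=\alpha_*\}$ is a $(d-1)$-dimensional $C^{5+\theta}$ $(\theta>0)$ hypersurface in $\mathbb{T}^d$ without boundary; $\nabla u_0$ is non-degenerate in the normal direction to $\Gamma_0$ at every point of $\Gamma_0$; $u_0>\alpha_*$ in $D_0^+$ and $u_-<u_0<\alpha_*$ in $D_0^-$, where $D_0^\pm$ are the regions separated by $\Gamma_0$. *)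

theory Defs
  imports "HOL-Probability.Probability" "HOL-Library.Landau_Symbols" "HOL-Number_Theory.Cong"
begin

section \<open>Zero-range invariant measures and the functions \<open>\<phi>\<close> and \<open>f\<close>\<close>

definition gfact :: "(nat \<Rightarrow> real) \<Rightarrow> nat \<Rightarrow> real" where
  "gfact g k = (\<Prod>j=1..k. g j)"

text \<open>The critical fugacity may be infinite.\<close>
definition fug_crit :: "(nat \<Rightarrow> real) \<Rightarrow> ereal" where
  "fug_crit g = liminf (\<lambda>k. ereal (g k))"

definition fug_dom :: "(nat \<Rightarrow> real) \<Rightarrow> real set" where
  "fug_dom g = {\<psi>. 0 \<le> \<psi> \<and> ereal \<psi> < fug_crit g}"

definition partition_fun :: "(nat \<Rightarrow> real) \<Rightarrow> real \<Rightarrow> real" where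
  "partition_fun g \<psi> = (\<Sum>k. \<psi> ^ k / gfact g k)"

definition marginal :: "(nat \<Rightarrow> real) \<Rightarrow> real \<Rightarrow> nat pmf" where
  "marginal g \<psi> = embed_pmf (\<lambda>k. (1 / partition_fun g \<psi>) * (\<psi> ^ k / gfact g k))"

definition nu_bar :: "(nat \<Rightarrow> real) \<Rightarrow> real \<Rightarrow> ((int ^ 'd) \<Rightarrow> nat) measure" where
  "nu_bar g \<psi> = (\<Pi>\<^sub>M x\<in>UNIV. measure_pmf (marginal g \<psi>))"

definition mean_density :: "(nat \<Rightarrow> real) \<Rightarrow> real \<Rightarrow> real" where
  "mean_density g \<psi> = measure_pmf.expectation (marginal g \<psi>) real"

text \<open>The filter is the left limit at the critical fugacity; it is \<open>at_top\<close> when the latter is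
  \<open>\<infinity>\<close>.\<close>
definition mean_diverges :: "(nat \<Rightarrow> real) \<Rightarrow> bool" where
  "mean_diverges g \<longleftrightarrow>
     filterlim (mean_density g) at_top (filtercomap ereal (at_left (fug_crit g)))"

definition fugacity :: "(nat \<Rightarrow> real) \<Rightarrow> real \<Rightarrow> real" where
  "fugacity g = the_inv_into (fug_dom g) (mean_density g)"

definition nu :: "(nat \<Rightarrow> real) \<Rightarrow> real \<Rightarrow> ((int ^ 'd) \<Rightarrow> nat) measure" where
  "nu g \<rho> = nu_bar g (fugacity g \<rho>)"

definition local_fun :: "(('i \<Rightarrow> nat) \<Rightarrow> real) \<Rightarrow> bool" where
  "local_fun c \<longleftrightarrow>
     (\<exists>\<Lambda>. finite \<Lambda> \<and> (\<forall>\<eta> \<xi>. (\<forall>x\<in>\<Lambda>. \<eta> x = \<xi> x) \<longrightarrow> c \<eta> = c \<xi>))"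

definition reaction ::
  "(nat \<Rightarrow> real) \<Rightarrow> (((int ^ 'd) \<Rightarrow> nat) \<Rightarrow> real) \<Rightarrow> (((int ^ 'd) \<Rightarrow> nat) \<Rightarrow> real) \<Rightarrow> real \<Rightarrow> real" where
  "reaction g cp cm \<rho> = (\<integral>\<eta>. cp \<eta> \<partial>nu g \<rho>) - (\<integral>\<eta>. cm \<eta> \<partial>nu g \<rho>)"

section \<open>Regularity classes\<close>

text \<open>\<open>C\<^sup>\<infinity>\<close> on \<open>[0,\<infinity>)\<close>, with one-sided derivatives at \<open>0\<close>; \<open>D n\<close> is the \<open>n\<close>-th derivative.\<close>
definition smooth_halfline :: "(real \<Rightarrow> real) \<Rightarrow> bool" where
  "smooth_halfline F \<longleftrightarrow>
     (\<exists>D :: nat \<Rightarrow> real \<Rightarrow> real. (\<forall>r\<ge>0. D 0 r = F r) \<and>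
        (\<forall>n. \<forall>r\<ge>0. (D n has_real_derivative D (Suc n) r) (at r within {0..})))"

text \<open>For open \<open>S\<close>: all partial derivatives up to order \<open>k\<close> exist and are continuous, and those of
  order \<open>k\<close> are locally \<open>\<theta>\<close>-Hoelder (no condition if \<open>\<theta> = 0\<close>).\<close>
primrec Ck_holder_on ::
  "nat \<Rightarrow> real \<Rightarrow> 'a::euclidean_space set \<Rightarrow> ('a \<Rightarrow> 'b::real_normed_vector) \<Rightarrow> bool" where
  "Ck_holder_on 0 \<theta> S F \<longleftrightarrow> continuous_on S F \<and>
     (\<theta> > 0 \<longrightarrow> (\<forall>C. compact C \<and> C \<subseteq> S \<longrightarrow>
        (\<exists>L. \<forall>x\<in>C. \<forall>y\<in>C. dist (F x) (F y) \<le> L * dist x y powr \<theta>)))"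
| "Ck_holder_on (Suc k) \<theta> S F \<longleftrightarrow> (\<forall>x\<in>S. F differentiable (at x)) \<and>
     (\<forall>b\<in>Basis. Ck_holder_on k \<theta> S (\<lambda>x. frechet_derivative F (at x) b))"

text \<open>The class \<open>C\<^sup>s\<close> for real \<open>s \<ge> 0\<close>: order \<open>\<lfloor>s\<rfloor>\<close> with Hoelder exponent \<open>s - \<lfloor>s\<rfloor>\<close>.\<close>
definition C_reg_on :: "real \<Rightarrow> 'a::euclidean_space set \<Rightarrow> ('a \<Rightarrow> 'b::real_normed_vector) \<Rightarrow> bool" where
  "C_reg_on s = Ck_holder_on (nat \<lfloor>s\<rfloor>) (s - of_int \<lfloor>s\<rfloor>)"

section \<open>The torus and hypersurfaces\<close>

text \<open>Functions on \<open>(\<real>/\<int>)\<^sup>d\<close> and \<open>(\<int>/N\<int>)\<^sup>d\<close> are represented by periodic functions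
  on \<open>\<real>\<^sup>d\<close> and \<open>\<int>\<^sup>d\<close>, and subsets of the torus by periodic subsets of \<open>\<real>\<^sup>d\<close>.\<close>

definition torus_fun :: "(real ^ 'd \<Rightarrow> 'b) \<Rightarrow> bool" where
  "torus_fun F \<longleftrightarrow> (\<forall>v w. (\<forall>i. v $ i - w $ i \<in> \<int>) \<longrightarrow> F v = F w)"

definition torus_set :: "(real ^ 'd) set \<Rightarrow> bool" where
  "torus_set A \<longleftrightarrow> torus_fun (\<lambda>v. v \<in> A)"

definition disc_torus_fun :: "nat \<Rightarrow> (int ^ 'd \<Rightarrow> 'b) \<Rightarrow> bool" where
  "disc_torus_fun N w \<longleftrightarrow> (\<forall>x y. (\<forall>i. [x $ i = y $ i] (mod int N)) \<longrightarrow> w x = w y)"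

definition scaled :: "nat \<Rightarrow> int ^ 'd \<Rightarrow> real ^ 'd" where
  "scaled N x = (\<chi> i. real_of_int (x $ i) / real N)"

text \<open>A \<open>C\<^sup>s\<close> hypersurface without boundary: near each of its points a \<open>C\<^sup>s\<close> diffeomorphism
  straightens it to a piece of a coordinate hyperplane. The condition is local, so it is the same
  for a subset of the torus and for its periodic lift.\<close>
definition C_hypersurface :: "real \<Rightarrow> (real ^ 'd) set \<Rightarrow> bool" where
  "C_hypersurface s \<Gamma> \<longleftrightarrow> closed \<Gamma> \<and>
     (\<forall>p\<in>\<Gamma>. \<exists>U V. \<exists>\<Phi> \<Psi> :: real ^ 'd \<Rightarrow> real ^ 'd. \<exists>i. open U \<and> p \<in> U \<and> open V \<and> homeomorphism U V \<Phi> \<Psi> \<and>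
        C_reg_on s U \<Phi> \<and> C_reg_on s V \<Psi> \<and> \<Phi> ` (\<Gamma> \<inter> U) = {y \<in> V. y $ i = 0})"

definition tangent_vector :: "(real ^ 'd) set \<Rightarrow> real ^ 'd \<Rightarrow> real ^ 'd \<Rightarrow> bool" where
  "tangent_vector \<Gamma> v w \<longleftrightarrow>
     (\<exists>c :: real \<Rightarrow> real ^ 'd. (\<forall>t. c t \<in> \<Gamma>) \<and> c 0 = v \<and> (c has_vector_derivative w) (at 0))"

definition unit_normal :: "(real ^ 'd) set \<Rightarrow> real ^ 'd \<Rightarrow> real ^ 'd \<Rightarrow> bool" where
  "unit_normal \<Gamma> v n \<longleftrightarrow> norm n = 1 \<and> (\<forall>w. tangent_vector \<Gamma> v w \<longrightarrow> n \<bullet> w = 0)"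

section \<open>The discrete equation\<close>

definition disc_laplace :: "nat \<Rightarrow> (int ^ 'd \<Rightarrow> real) \<Rightarrow> int ^ 'd \<Rightarrow> real" where
  "disc_laplace N w x = (real N)\<^sup>2 * (\<Sum>i\<in>UNIV. w (x + axis i 1) + w (x - axis i 1) - 2 * w x)"

text \<open>Since \<open>\<phi>\<close> and \<open>f\<close> are functions on \<open>[0,\<infinity>)\<close>, solutions are nonnegative.\<close>
definition solves_disc ::
  "nat \<Rightarrow> real \<Rightarrow> (real \<Rightarrow> real) \<Rightarrow> (real \<Rightarrow> real) \<Rightarrow> (real \<Rightarrow> int ^ 'd \<Rightarrow> real) \<Rightarrow> bool" where
  "solves_disc N k \<phi> f u \<longleftrightarrow>
     (\<forall>t\<ge>0. disc_torus_fun N (u t) \<and> (\<forall>x. 0 \<le> u t x)) \<and>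
     (\<forall>t\<ge>0. \<forall>x. ((\<lambda>s. u s x) has_real_derivative
         (disc_laplace N (\<lambda>y. \<phi> (u t y)) x + k * f (u t x))) (at t within {0..}))"

end

theory Submission
  imports Defs
begin

text \<open>
  Write \<open>\<gamma> = f'(as)\<close>. Near the unstable zero the reaction multiplies the excess \<open>u - as\<close> by
  \<open>exp (\<gamma> K t)\<close>, which is \<open>\<surd>K\<close> at the time \<open>t\<^sup>N\<close>. An initial excess of order \<open>1 / \<surd>K\<close> thus becomes of
  order one, and it remains to see that the diffusion cannot undo this.

  The lower bounds come from an explicit subsolution. Choose a profile \<open>H\<close> that increases through
  \<open>H 0 = 0\<close> with slope \<open>1\<close> up to a limit \<open>R\<close> slightly below \<open>ap - as\<close>, and that, above a fixed
  height, satisfies \<open>\<gamma> z H'(z) \<le> f (as + H z)\<close>; then \<open>as + H (exp (\<gamma> K t) z)\<close> is a subsolution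
  of the ordinary differential equation while it stays above that height. The formula \<open>H z = R (1 - (1 + n z / R)^(-1/n))\<close> with \<open>n\<close> large
  does this (\<open>profile_slow\<close>). In space, replace \<open>z\<close> by \<open>u(0, x) - as - (C / K) exp (\<gamma> K t)\<close>. The
  discrete Laplacian of \<open>\<phi> (as + H(\<zeta>))\<close> is bounded by a constant times \<open>H'(\<zeta>) exp (2 \<gamma> K t)\<close>,
  because \<open>H''\<close> is bounded there by a multiple of \<open>H'\<close>, and the moving shift gains a term of exactly this
  form (\<open>interface_lower_bound\<close>). At time \<open>t\<^sup>N\<close> the shift is only of order \<open>1 / \<surd>K\<close>, the order of
  the admitted distance from \<open>as\<close>. Comparing Taylor remainders at neighbouring lattice points
  requires the values of \<open>\<zeta>\<close> there to be close, that is, \<open>\<surd>K / N \<rightarrow> 0\<close>; this follows from the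
  growth condition on \<open>K\<close>, whose exponent is below \<open>1\<close> because \<open>\<gamma>b > 0\<close>.

  Where \<open>H\<close> becomes too negative the subsolution is replaced by a constant: as \<open>f > 0\<close> on \<open>[0, am)\<close>,
  a spatially constant barrier pushes the solution above \<open>am - \<delta>\<close> before time \<open>t\<^sup>N\<close>
  (\<open>constant_barrier\<close>). Both barriers are compared with the solution at a first point of contact
  (\<open>strict_comparison\<close>), which together gives \<open>interface_generation_lower\<close>.

  The upper bounds are the lower bounds for \<open>- u\<close>, which solves the equation with
  \<open>- \<phi> (- r)\<close> and \<open>- f (- r)\<close> in place of \<open>\<phi>\<close> and \<open>f\<close>.
\<close>

section \<open>Quadratic lower bounds\<close>

definition C2_on :: "real set \<Rightarrow> (real \<Rightarrow> real) \<Rightarrow> (real \<Rightarrow> real) \<Rightarrow> (real \<Rightarrow> real) \<Rightarrow> bool" where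
  "C2_on J F F' F'' \<longleftrightarrow> continuous_on J F'' \<and>
     (\<forall>r\<in>J. (F has_real_derivative F' r) (at r) \<and> (F' has_real_derivative F'' r) (at r))"

text \<open>Adding \<open>m r\<^sup>2 / 2\<close> makes \<open>F\<close> convex, so that it lies above its tangents.\<close>
lemma quadratic_lower_bound:
  fixes F F' F'' :: "real \<Rightarrow> real"
  assumes "convex I" "x \<in> I" "y \<in> I"
    and F: "\<And>r. r \<in> I \<Longrightarrow> (F has_real_derivative F' r) (at r)"
    and F': "\<And>r. r \<in> I \<Longrightarrow> (F' has_real_derivative F'' r) (at r)"
    and lower: "\<And>r. r \<in> I \<Longrightarrow> - m \<le> F'' r"
  shows "F x + F' x * (y - x) - m / 2 * (y - x)\<^sup>2 \<le> F y"
proof -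
  have "(F' x + m * x) * (y - x) \<le> (F y + m / 2 * y\<^sup>2) - (F x + m / 2 * x\<^sup>2)"
  proof (rule f''_imp_f'[where C = I and f = "\<lambda>r. F r + m / 2 * r\<^sup>2" and f' = "\<lambda>r. F' r + m * r"
        and f'' = "\<lambda>r. F'' r + m"])
    show "((\<lambda>r. F r + m / 2 * r\<^sup>2) has_real_derivative F' r + m * r) (at r)" if "r \<in> I" for r
      by (rule derivative_eq_intros F that refl | simp)+
    show "((\<lambda>r. F' r + m * r) has_real_derivative F'' r + m) (at r)" if "r \<in> I" for r
      by (rule derivative_eq_intros F' that refl | simp)+
    show "0 \<le> F'' r + m" if "r \<in> I" for r using lower[OF that] by simp
  qed (use assms in auto)
  then show ?thesis by (simp add: algebra_simps power2_eq_square)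
qed

section \<open>An explicit profile for the escape from the unstable zero\<close>

text \<open>A flow \<open>\<eta>' = \<gamma> q(\<eta>)\<close> with \<open>q(0) = 0\<close> and \<open>q'(0) = 1\<close> is linearised near its unstable zero:
  \<open>\<eta>(t) = H (exp (\<gamma> t) z)\<close>, where \<open>z H'(z) = q (H z)\<close>. The profile is the solution \<open>H\<close> for
  \<open>q(y) = (R / n) (1 - (1 - y / R)^n) (1 - y / R)\<close>, which vanishes again at \<open>R\<close>. For large \<open>n\<close>
  it climbs towards \<open>R\<close> slowly and falls below \<open>0\<close> quickly, which is what makes it a
  subsolution. It is defined where \<open>1 + n z / R > 0\<close>.\<close>
definition profile :: "real \<Rightarrow> nat \<Rightarrow> real \<Rightarrow> real" where
  "profile R n z = R * (1 - (1 + real n * z / R) powr (- 1 / real n))"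

definition profile_deriv :: "real \<Rightarrow> nat \<Rightarrow> real \<Rightarrow> real" where
  "profile_deriv R n z = (1 + real n * z / R) powr (- 1 / real n - 1)"

definition profile_inv :: "real \<Rightarrow> nat \<Rightarrow> real \<Rightarrow> real" where
  "profile_inv R n y = R / real n * (1 / (1 - y / R) ^ n - 1)"

context
  fixes R :: real and n :: nat
  assumes R: "R > 0" and n: "n > 0"
begin

lemma profile_has_derivative:
  assumes "1 + real n * z / R > 0"
  shows "(profile R n has_real_derivative profile_deriv R n z) (at z)"
  unfolding profile_def profile_deriv_def using assms R n
  by (auto intro!: derivative_eq_intros simp: field_simps)

lemma profile_deriv_has_derivative:
  assumes "1 + real n * z / R > 0"
  shows "(profile_deriv R n has_real_derivative
     - ((real n + 1) / R) * (profile_deriv R n z / (1 + real n * z / R))) (at z)"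
proof -
  let ?X = "1 + real n * z / R" and ?a = "- 1 / real n - 1"
  have "((\<lambda>z. 1 + real n * z / R) has_real_derivative real n / R) (at z)"
    using R by (auto intro!: derivative_eq_intros)
  then have "(profile_deriv R n has_real_derivative ?a * ?X powr (?a - 1) * (real n / R)) (at z)"
    unfolding profile_deriv_def 
    by (rule DERIV_chain2[where f = "\<lambda>X. X powr ?a" and g = "\<lambda>z. 1 + real n * z / R",
          OF has_real_derivative_powr[OF assms]])
  moreover have "?X powr (?a - 1) = profile_deriv R n z / ?X"
    using assms powr_diff[of ?X ?a 1] by (simp add: profile_deriv_def)
  moreover have "?a * q * (real n / R) = - ((real n + 1) / R) * q" for q
    using n R by (simp add: field_simps)
  ultimately show ?thesis by metis
qed

lemma profile_deriv_pos:
  assumes "1 + real n * z / R > 0"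
  shows "profile_deriv R n z > 0"
  using assms unfolding profile_deriv_def by simp

text \<open>The profile is concave with slope \<open>1\<close> at \<open>0\<close>; the inequality says that the barrier built from
  it starts below the initial datum.\<close>
lemma profile_le_id:
  assumes "1 + real n * z / R > 0"
  shows "profile R n z \<le> z"
proof -
  let ?X = "1 + real n * z / R"
  have "1 - z / R = 1 - (?X - 1) / n" using R n by (simp add: field_simps)
  also have "\<dots> \<le> 1 - ln ?X / n"
    using divide_right_mono[OF ln_le_minus_one[OF assms], of "real n"] n by simp
  also have "\<dots> \<le> exp (- ln ?X / n)" using exp_ge_add_one_self[of "- ln ?X / n"] by simp
  also have "\<dots> = ?X powr (- 1 / n)" using assms by (simp add: powr_def)
  finally have "1 - ?X powr (- 1 / n) \<le> z / R" by simp
  then have "R * (1 - ?X powr (- 1 / n)) \<le> R * (z / R)" using R by (intro mult_left_mono) auto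
  then show ?thesis unfolding profile_def using R by simp
qed

lemma profile_less:
  assumes "1 + real n * z / R > 0"
  shows "profile R n z < R"
proof -
  have "0 < (1 + real n * z / R) powr (- 1 / n)" using assms by simp
  then show ?thesis unfolding profile_def using R by (simp add: mult_less_cancel_left1)
qed

lemma profile_deriv_antimono:
  assumes "1 + real n * z / R > 0" "z \<le> z'"
  shows "profile_deriv R n z' \<le> profile_deriv R n z"
proof -
  have "0 \<le> 1 / real n" by simp
  then have "- 1 / real n - 1 \<le> 0" by linarith
  then show ?thesis unfolding profile_deriv_def
    by (rule powr_mono2') (use assms R in \<open>auto intro!: divide_right_mono mult_left_mono\<close>)
qed

lemma profile_mono:
  assumes "1 + real n * z / R > 0" "z \<le> z'"
  shows "profile R n z \<le> profile R n z'"
  unfolding profile_def using assms R n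
  by (auto intro!: mult_left_mono powr_mono2' divide_right_mono)

lemma profile_inv_pos:
  assumes "y < R"
  shows "1 + real n * profile_inv R n y / R > 0"
proof -
  have "1 - y / R > 0" using assms R by simp
  then show ?thesis using R n by (simp add: profile_inv_def)
qed

lemma profile_profile_inv:
  assumes "y < R"
  shows "profile R n (profile_inv R n y) = y"
proof -
  have P: "1 - y / R > 0" using assms R by simp
  have "1 + real n * profile_inv R n y / R = (1 - y / R) powr (- real n)"
    using R n P by (simp add: profile_inv_def powr_minus_divide powr_realpow)
  then have "profile R n (profile_inv R n y) = R * (1 - (1 - y / R) powr 1)"
    using n by (simp add: profile_def powr_powr)
  also have "\<dots> = y" using P R by (simp add: field_simps)
  finally show ?thesis .
qed

lemma profile_inv_mono:
  assumes "y \<le> y'" "y' < R"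
  shows "profile_inv R n y \<le> profile_inv R n y'"
proof -
  have "(1 - y' / R) ^ n \<le> (1 - y / R) ^ n" "(1 - y' / R) ^ n > 0"
    using assms R by (auto intro!: power_mono divide_right_mono)
  then show ?thesis unfolding profile_inv_def using R n
    by (intro mult_left_mono) (auto intro!: divide_left_mono)
qed

text \<open>With \<open>P = 1 - H z / R\<close> one has \<open>1 + n z / R = P^(-n)\<close>, so that \<open>z H'(z)\<close> becomes a polynomial
  in \<open>P\<close>, that is, in the height \<open>H z\<close> alone.\<close>
lemma profile_speed:
  assumes "1 + real n * z / R > 0"
  shows "z * profile_deriv R n z =
     R / n * (1 - (1 - profile R n z / R) ^ n) * (1 - profile R n z / R)"
proof -
  define X where "X = 1 + real n * z / R"
  have X: "X > 0" using assms X_def by simp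
  have P: "1 - profile R n z / R = X powr (- 1 / n)" using R by (simp add: profile_def X_def)
  have Pn: "(X powr (- 1 / n)) ^ n = 1 / X"
  proof -
    have "(X powr (- 1 / n)) ^ n = (X powr (- 1 / n)) powr n" using X by (simp add: powr_realpow)
    also have "\<dots> = X powr (- 1)" using n by (simp add: powr_powr)
    finally show ?thesis using X by (simp add: powr_minus divide_inverse)
  qed
  have D: "profile_deriv R n z = X powr (- 1 / n) / X"
    using X by (simp add: profile_deriv_def X_def powr_diff)
  have z: "z = R / n * (X - 1)" using R n by (simp add: X_def field_simps)
  have "z * profile_deriv R n z = R / n * (1 - 1 / X) * X powr (- 1 / n)"
    unfolding D by (subst z) (use X in \<open>simp add: field_simps\<close>)
  then show ?thesis unfolding P Pn .
qed

end

text \<open>The two power estimates below are the two signs of one fact: the factor \<open>1 - (1 - v)^n\<close> of the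
  speed lies below \<open>n v\<close> by a quadratic amount whose coefficient grows with \<open>n\<close>. For \<open>v > 0\<close>
  this can only hold in the saturating form \<open>n v / (1 + (n - 1) v / 2)\<close>.\<close>
lemma one_minus_power_le:
  fixes v :: real
  assumes "0 \<le> v" "v \<le> 1"
  shows "(1 - (1 - v) ^ Suc n) * (1 + real n * v / 2) \<le> real (Suc n) * v"
proof (induction n)
  case 0
  then show ?case by simp
next
  case (Suc n)
  define D where "D = 1 + real n * v / 2"
  have D: "D \<ge> 1" using assms by (simp add: D_def)
  define P where "P = 1 - (1 - v) ^ Suc n"
  have "P * D \<le> real (Suc n) * v" using Suc unfolding P_def D_def .
  then have P: "P \<le> real (Suc n) * v / D" using D by (simp add: pos_le_divide_eq)
  have "1 - (1 - v) ^ Suc (Suc n) = v + (1 - v) * P" by (simp add: P_def algebra_simps)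
  also have "\<dots> \<le> v + (1 - v) * (real (Suc n) * v / D)"
    using P assms by (intro add_left_mono mult_left_mono) auto
  finally have "(1 - (1 - v) ^ Suc (Suc n)) * (D + v / 2) \<le> (v + (1 - v) * (real (Suc n) * v / D)) * (D + v / 2)"
    using D assms by (intro mult_right_mono) auto
  also have "\<dots> \<le> real (Suc (Suc n)) * v"
  proof -
    have "(D + (1 - v) * (real n + 1)) * (D + v / 2) = (real n + 2) * (D - (real n + 1) * v\<^sup>2 / 4)"
      by (simp add: D_def algebra_simps power2_eq_square)
    also have "\<dots> \<le> (real n + 2) * D" using assms by (intro mult_left_mono) auto
    finally have "v * ((D + (1 - v) * (real n + 1)) * (D + v / 2)) \<le> v * ((real n + 2) * D)"
      using assms by (intro mult_left_mono) auto
    then have "v * ((D + (1 - v) * (real n + 1)) * (D + v / 2)) / D \<le> v * (real n + 2)"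
      using D by (simp add: pos_divide_le_eq mult.assoc)
    moreover have "(v + (1 - v) * (real (Suc n) * v / D)) * (D + v / 2)
      = v * ((D + (1 - v) * (real n + 1)) * (D + v / 2)) / D" using D by (simp add: field_simps)
    ultimately show ?thesis by (simp add: algebra_simps)
  qed
  finally show ?case by (simp add: D_def algebra_simps add_divide_distrib)
qed

lemma one_plus_power_ge:
  fixes w :: real
  assumes "0 \<le> w"
  shows "1 + real (Suc n) * w + real (Suc n) * real n / 2 * w\<^sup>2 \<le> (1 + w) ^ Suc n"
proof (induction n)
  case 0
  then show ?case by simp
next
  case (Suc n)
  have "1 + real (Suc (Suc n)) * w + real (Suc (Suc n)) * real (Suc n) / 2 * w\<^sup>2
     \<le> (1 + w) * (1 + real (Suc n) * w + real (Suc n) * real n / 2 * w\<^sup>2)"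
  proof -
    have "0 \<le> real (Suc n) * real n / 2 * w\<^sup>2 * w" using assms by simp
    then show ?thesis by (simp add: algebra_simps power2_eq_square add_divide_distrib)
  qed
  also have "\<dots> \<le> (1 + w) * (1 + w) ^ Suc n" using assms by (intro mult_left_mono Suc) auto
  finally show ?case by simp
qed

text \<open>A reaction term with derivative \<open>\<gamma>\<close> at the unstable zero satisfies
  \<open>f (s + y) \<ge> \<gamma> y - B y\<^sup>2\<close>, which is a useful bound as long as \<open>y\<close> is at most \<open>\<gamma> / (2 B)\<close>; above that
  height only a positive constant \<open>m\<close> is available. For large \<open>n\<close> the speed of the profile stays
  below both: the quadratic correction of the speed is of order \<open>n\<close>, and the speed at positive
  heights is at most \<open>\<gamma> R / n\<close>.\<close>
lemma profile_slow:
  fixes R \<gamma> B m :: real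
  assumes R: "R > 0" and \<gamma>: "\<gamma> > 0" and B: "B > 0" and m: "m > 0"
  shows "\<exists>n>0. \<forall>z. 1 + real n * z / R > 0 \<longrightarrow>
     (profile R n z \<le> \<gamma> / (2 * B) \<longrightarrow>
        \<gamma> * (z * profile_deriv R n z) \<le> \<gamma> * profile R n z - B * (profile R n z)\<^sup>2) \<and>
     (profile R n z \<ge> 0 \<longrightarrow> \<gamma> * (z * profile_deriv R n z) \<le> m)"
proof -
  obtain j :: nat where j: "real j \<ge> 4 * B * R / \<gamma> + \<gamma> * R / m"
    using real_arch_simple by blast
  have mB: "0 \<le> 4 * B * R / \<gamma>" "0 \<le> \<gamma> * R / m" using R \<gamma> B m by auto
  define n where "n = Suc j"
  have n: "n > 0" by (simp add: n_def)
  define k where "k = B * R / \<gamma>"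
  have k: "k > 0" using R \<gamma> B by (simp add: k_def)
  have jk: "real j \<ge> 4 * k" using j mB by (simp add: k_def)
  have small: "\<gamma> * (z * profile_deriv R n z) \<le> \<gamma> * profile R n z - B * (profile R n z)\<^sup>2"
    if X: "1 + real n * z / R > 0" and y: "profile R n z \<le> \<gamma> / (2 * B)" for z
  proof -
    define v where "v = profile R n z / R"
    have yv: "profile R n z = R * v" using R by (simp add: v_def)
    have v1: "v < 1" using profile_less[OF R n X] R by (simp add: v_def)
    have vk: "k * v \<le> 1 / 2"
    proof -
      have "B * (R * v) \<le> \<gamma> / 2" using y B unfolding yv by (simp add: field_simps)
      then show ?thesis using \<gamma> by (simp add: k_def field_simps)
    qed
    have main: "(1 - (1 - v) ^ n) * (1 - v) \<le> real n * (v - k * v\<^sup>2)"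
    proof (cases "v \<ge> 0")
      case True
      define c where "c = real j / 2"
      have c: "c \<ge> 2 * k" using jk by (simp add: c_def)
      have cv: "c * v \<ge> 0" using c k True by simp
      have pw: "(1 - (1 - v) ^ n) \<ge> 0" using True v1 by (simp add: power_le_one)
      have "(1 - (1 - v) ^ n) * (1 + c * v) \<le> real n * v"
        using one_minus_power_le[of v j] True v1 by (simp add: n_def c_def)
      also have "\<dots> \<le> real n * v * ((1 + c * v) * (1 - k * v))"
      proof -
        have "c * v * (k * v) \<le> c * v * (1 / 2)" using cv vk by (intro mult_left_mono) auto
        moreover have "k * v \<le> c * v * (1 / 2)"
          using c True mult_right_mono[of "2 * k" c v] by simp
        ultimately have "1 \<le> (1 + c * v) * (1 - k * v)" by (simp add: algebra_simps)
        then show ?thesis using True mult_left_mono[of 1 "(1 + c * v) * (1 - k * v)" "real n * v"] by simp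
      qed
      finally have "(1 - (1 - v) ^ n) * (1 + c * v) \<le> (real n * v * (1 - k * v)) * (1 + c * v)"
        by (simp add: algebra_simps)
      then have "1 - (1 - v) ^ n \<le> real n * v * (1 - k * v)"
        using cv by (subst (asm) mult_le_cancel_right_pos) auto
      moreover have "(1 - (1 - v) ^ n) * (1 - v) \<le> 1 - (1 - v) ^ n"
        using pw True v1 by (intro mult_left_le) auto
      ultimately show ?thesis by (simp add: algebra_simps power2_eq_square)
    next
      case False
      define w where "w = - v"
      have w: "w > 0" using False by (simp add: w_def)
      have "1 + real n * w + real n * real j / 2 * w\<^sup>2 \<le> (1 + w) ^ n"
        using one_plus_power_ge[of w j] w by (simp add: n_def)
      moreover have "real n * (k * w\<^sup>2) \<le> real n * (real j / 2 * w\<^sup>2)"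
        using jk k by (intro mult_left_mono mult_right_mono) auto
      ultimately have *: "real n * (w + k * w\<^sup>2) \<le> (1 + w) ^ n - 1" by (simp add: algebra_simps)
      moreover have "(1 + w) ^ n - 1 \<le> ((1 + w) ^ n - 1) * (1 + w)"
        using w by (intro mult_le_cancel_left1[THEN iffD2]) (auto simp: not_less)
      ultimately show ?thesis by (simp add: w_def algebra_simps)
    qed
    have "\<gamma> * (z * profile_deriv R n z) = \<gamma> * R / n * ((1 - (1 - v) ^ n) * (1 - v))"
      unfolding profile_speed[OF R n X] by (simp add: v_def)
    also have "\<dots> \<le> \<gamma> * R / n * (real n * (v - k * v\<^sup>2))"
      using main \<gamma> R by (intro mult_left_mono) auto
    also have "\<dots> = \<gamma> * profile R n z - B * (profile R n z)\<^sup>2"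
      unfolding yv k_def using n \<gamma> by (simp add: field_simps power2_eq_square)
    finally show ?thesis .
  qed
  have large: "\<gamma> * (z * profile_deriv R n z) \<le> m"
    if X: "1 + real n * z / R > 0" and y: "profile R n z \<ge> 0" for z
  proof -
    define v where "v = profile R n z / R"
    have v: "v < 1" "0 \<le> v" using profile_less[OF R n X] R y by (auto simp: v_def)
    have "(1 - (1 - v) ^ n) * (1 - v) \<le> 1 * 1" using v by (intro mult_mono) auto
    then have "\<gamma> * R / n * ((1 - (1 - v) ^ n) * (1 - v)) \<le> \<gamma> * R / n * 1"
      using R \<gamma> by (intro mult_left_mono) auto
    also have "\<dots> \<le> m"
    proof -
      have "\<gamma> * R / m \<le> real n" using j mB by (simp add: n_def)
      then show ?thesis using m n by (simp add: field_simps)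
    qed
    finally show ?thesis unfolding profile_speed[OF R n X] by (simp add: v_def)
  qed
  show ?thesis using n small large by blast
qed

section \<open>Comparison on the discrete torus\<close>

text \<open>The sign of \<open>u\<close> is left free, so that the notion is invariant under \<open>u \<mapsto> - u\<close>.\<close>
definition solves_lattice ::
  "nat \<Rightarrow> real \<Rightarrow> (real \<Rightarrow> real) \<Rightarrow> (real \<Rightarrow> real) \<Rightarrow> (real \<Rightarrow> int ^ 'd \<Rightarrow> real) \<Rightarrow> bool" where
  "solves_lattice N k \<phi> f u \<longleftrightarrow>
     (\<forall>t\<ge>0. disc_torus_fun N (u t)) \<and>
     (\<forall>t\<ge>0. \<forall>x. ((\<lambda>s. u s x) has_real_derivative
         (disc_laplace N (\<lambda>y. \<phi> (u t y)) x + k * f (u t x))) (at t within {0..}))"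

text \<open>Reflection turns upper bounds into lower bounds: \<open>r \<mapsto> - \<phi> (- r)\<close> is again increasing, and
  the unstable zero \<open>as\<close> becomes the unstable zero \<open>- as\<close> with the same slope.\<close>
lemma solves_lattice_reflect:
  assumes "solves_lattice N k \<phi> f u"
  shows "solves_lattice N k (\<lambda>r. - \<phi> (- r)) (\<lambda>r. - f (- r)) (\<lambda>t x. - u t x)"
proof -
  have L: "disc_laplace N (\<lambda>y. - w y) x = - disc_laplace N w x" for w and x :: "int ^ 'd"
  proof -
    have "(\<Sum>i\<in>UNIV. - w (x + axis i 1) + - w (x - axis i 1) - 2 * - w x)
        = - (\<Sum>i\<in>UNIV. w (x + axis i 1) + w (x - axis i 1) - 2 * w x)"
      unfolding sum_negf[symmetric] by (rule sum.cong) auto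
    then show ?thesis by (simp add: disc_laplace_def)
  qed
  have "((\<lambda>s. - u s x) has_real_derivative
      (disc_laplace N (\<lambda>y. - \<phi> (- (- u t y))) x + k * (- f (- (- u t x))))) (at t within {0..})"
    if "t \<ge> 0" for t x
  proof -
    have "((\<lambda>s. u s x) has_real_derivative
         (disc_laplace N (\<lambda>y. \<phi> (u t y)) x + k * f (u t x))) (at t within {0..})"
      using assms that unfolding solves_lattice_def by blast
    from DERIV_minus[OF this] show ?thesis by (simp add: L)
  qed
  then show ?thesis using assms unfolding solves_lattice_def disc_torus_fun_def by simp
qed

text \<open>The set of times at which some component is nonpositive is compact, because there are only
  finitely many components; its least element is the time at which positivity is first lost.\<close>
lemma first_zero:
  fixes d :: "real \<Rightarrow> 'a \<Rightarrow> real"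
  assumes "finite X" and cont: "\<And>x. x \<in> X \<Longrightarrow> continuous_on {0..T} (\<lambda>t. d t x)"
    and init: "\<And>x. x \<in> X \<Longrightarrow> 0 < d 0 x"
    and neg: "t \<in> {0..T}" "x \<in> X" "d t x \<le> 0"
  obtains s y where "0 < s" "s \<le> T" "y \<in> X" "d s y = 0" "\<forall>x\<in>X. 0 \<le> d s x"
    "\<forall>r\<in>{0..<s}. \<forall>x\<in>X. 0 < d r x"
proof -
  define S where "S = (\<Union>x\<in>X. {t\<in>{0..T}. d t x \<in> {..0}})"
  have "closed {t\<in>{0..T}. d t x \<in> {..0}}" if "x \<in> X" for x
  proof -
    have "closed ({0..T} \<inter> (\<lambda>t. d t x) -` {..0})"
      by (rule continuous_closed_preimage[OF cont[OF that]]) auto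
    moreover have "{t\<in>{0..T}. d t x \<in> {..0}} = {0..T} \<inter> (\<lambda>t. d t x) -` {..0}" by blast
    ultimately show ?thesis by metis
  qed
  then have "closed S" unfolding S_def using \<open>finite X\<close> by (intro closed_UN) auto
  moreover have "bounded S" unfolding S_def
    by (rule bounded_subset[of "{0..T}"]) (auto simp: bounded_closed_interval)
  ultimately have "compact S" by (simp add: compact_eq_bounded_closed)
  moreover have "S \<noteq> {}" using neg unfolding S_def by auto
  ultimately have "\<exists>s\<in>S. \<forall>r\<in>S. s \<le> r" by (rule compact_attains_inf)
  then obtain s where s: "s \<in> S" "\<And>r. r \<in> S \<Longrightarrow> s \<le> r" by blast
  then obtain y where y: "y \<in> X" "d s y \<le> 0" and sT: "0 \<le> s" "s \<le> T" unfolding S_def by auto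
  have s0: "0 < s" using y init[of y] sT by (cases "s = 0") auto
  have before: "0 < d r x" if "0 \<le> r" "r < s" "x \<in> X" for r x
  proof (rule ccontr)
    assume "\<not> 0 < d r x"
    then have "r \<in> S" using that sT unfolding S_def by (auto simp: not_less intro!: bexI[of _ x])
    then show False using s(2) that by force
  qed
  have at: "0 \<le> d s x" if "x \<in> X" for x
  proof (rule tendsto_lowerbound)
    have "continuous_on {0..s} (\<lambda>t. d t x)"
      by (rule continuous_on_subset[OF cont[OF that]]) (use sT in auto)
    then show "((\<lambda>t. d t x) \<longlongrightarrow> d s x) (at_left s)"
      by (rule continuous_on_Icc_at_leftD[OF _ s0])
    show "eventually (\<lambda>t. 0 \<le> d t x) (at_left s)"
      using before[OF _ _ that] s0 by (auto simp: eventually_at_left intro!: exI[of _ 0] less_imp_le)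
  qed simp
  have "d s y = 0" using at[OF y(1)] y(2) by simp
  then show thesis by (rule that[OF s0 sT(2) y(1)]) (use at before in auto)
qed

definition torus_box :: "nat \<Rightarrow> (int ^ 'd) set" where
  "torus_box N = {x. \<forall>i. x $ i \<in> {0..<int N}}"

lemma finite_torus_box: "finite (torus_box N :: (int ^ 'd) set)"
proof -
  have "finite {f :: 'd \<Rightarrow> int. \<forall>i. f i \<in> {0..<int N}}"
    using finite_set_of_finite_funs[of "UNIV :: 'd set" "{0..<int N}" undefined] by simp
  then have "finite ((\<lambda>x :: int ^ 'd. ($) x) -` {f. \<forall>i. f i \<in> {0..<int N}})"
    by (rule finite_vimageI) (auto simp: inj_def vec_eq_iff fun_eq_iff)
  then show ?thesis by (simp add: torus_box_def vimage_def)
qed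

lemma torus_box_representative:
  fixes x :: "int ^ 'd"
  assumes "N \<ge> 1"
  obtains y where "y \<in> torus_box N" "\<And>w. disc_torus_fun N w \<Longrightarrow> w x = w y"
proof
  show "(\<chi> i. x $ i mod int N) \<in> torus_box N" using assms by (simp add: torus_box_def)
  show "w x = w (\<chi> i. x $ i mod int N)" if "disc_torus_fun N w" for w :: "int ^ 'd \<Rightarrow> 'b"
    using that unfolding disc_torus_fun_def by (simp add: cong_def)
qed

lemma disc_laplace_mono_at:
  assumes "\<And>y. v y \<le> w y" "v x = w x"
  shows "disc_laplace N v x \<le> disc_laplace N w x"
  unfolding disc_laplace_def using assms
  by (intro mult_left_mono sum_mono diff_mono add_mono) auto

lemma left_touching_derivative:
  fixes h :: "real \<Rightarrow> real"
  assumes "(h has_real_derivative D) (at t within {0..})" "0 < t" "h t = 0"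
    and "\<forall>\<^sub>F s in at_left t. 0 \<le> h s"
  shows "D \<le> 0"
proof (rule ccontr)
  assume "\<not> D \<le> 0"
  then obtain e where e: "e > 0" "\<And>r. r > 0 \<Longrightarrow> t - r \<in> {0..} \<Longrightarrow> r < e \<Longrightarrow> h (t - r) < h t"
    using has_real_derivative_pos_inc_left[OF assms(1)] by auto
  obtain b where b: "b < t" "\<And>s. b < s \<Longrightarrow> s < t \<Longrightarrow> 0 \<le> h s"
    using assms(4) by (auto simp: eventually_at_left_field)
  define r where "r = min (min (e / 2) (t / 2)) ((t - b) / 2)"
  have "r > 0" "r < e" "r \<le> t" "b < t - r" using e b assms(2) by (auto simp: r_def min_def field_simps)
  then show False using e(2)[of r] b(2)[of "t - r"] assms(3) by simp
qed

text \<open>At the first contact of \<open>u\<close> with a barrier \<open>W\<close> the difference decreases to \<open>0\<close>, so it has a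
  nonpositive derivative. The barrier only has to be differentiable through a minorant \<open>V\<close> that
  agrees with it at the contact time; this admits barriers that are maxima of smooth functions.\<close>
lemma strict_comparison:
  fixes u W :: "real \<Rightarrow> int ^ 'd \<Rightarrow> real"
  assumes N: "N \<ge> 1" and u: "solves_lattice N k \<phi> f u"
    and Wper: "\<And>t. 0 \<le> t \<Longrightarrow> disc_torus_fun N (W t)"
    and Wcont: "\<And>x. continuous_on {0..T} (\<lambda>t. W t x)"
    and init: "\<And>x. W 0 x < u 0 x"
    and touch: "\<And>t x. 0 < t \<Longrightarrow> t \<le> T \<Longrightarrow> (\<And>y. W t y \<le> u t y) \<Longrightarrow> u t x = W t x \<Longrightarrow>
      \<exists>V D. (V has_real_derivative D) (at t within {0..}) \<and> V t = W t x \<and>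
        (\<forall>\<^sub>F s in at_left t. V s \<le> W s x) \<and>
        D < disc_laplace N (\<lambda>y. \<phi> (u t y)) x + k * f (u t x)"
    and t: "0 \<le> t" "t \<le> T"
  shows "W t x < u t x"
proof (rule ccontr)
  assume neg: "\<not> W t x < u t x"
  have du: "((\<lambda>s. u s x) has_real_derivative
      (disc_laplace N (\<lambda>y. \<phi> (u t y)) x + k * f (u t x))) (at t within {0..})" if "0 \<le> t" for t x
    using u that unfolding solves_lattice_def by blast
  have uper: "disc_torus_fun N (u t)" if "0 \<le> t" for t
    using u that unfolding solves_lattice_def by blast
  define d where "d t y = u t y - W t y" for t y
  have ucont: "continuous_on {0..T} (\<lambda>t. u t x)" for x
  proof -
    have "continuous_on {0..} (\<lambda>t. u t x)"
      using du by (auto simp: continuous_on_eq_continuous_within intro!: DERIV_continuous)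
    then show ?thesis by (rule continuous_on_subset) auto
  qed
  obtain z where z: "z \<in> torus_box N" "\<And>w :: int ^ 'd \<Rightarrow> real. disc_torus_fun N w \<Longrightarrow> w x = w z"
    using torus_box_representative[OF N, of x] by blast
  have cont: "continuous_on {0..T} (\<lambda>t. d t x)" for x
    unfolding d_def by (intro continuous_on_diff ucont Wcont)
  have d0: "0 < d 0 x" for x using init by (simp add: d_def)
  have dz: "d t z \<le> 0" using neg z(2)[OF uper] z(2)[OF Wper] t by (simp add: d_def)
  have tT: "t \<in> {0..T}" using t by simp
  obtain s y where s: "0 < s" "s \<le> T" and y: "y \<in> torus_box N" "d s y = 0"
    and nn: "\<forall>x\<in>torus_box N. 0 \<le> d s x"
    and before: "\<forall>r\<in>{0..<s}. \<forall>x\<in>torus_box N. 0 < d r x"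
    by (rule first_zero[where X = "torus_box N" and T = T and d = d, OF finite_torus_box cont d0 tT z(1) dz])
  have "W s y' \<le> u s y'" for y'
  proof -
    obtain z' where z': "z' \<in> torus_box N" "\<And>w :: int ^ 'd \<Rightarrow> real. disc_torus_fun N w \<Longrightarrow> w y' = w z'"
      using torus_box_representative[OF N, of y'] by blast
    then show ?thesis using nn z'(2)[OF uper] z'(2)[OF Wper] s by (simp add: d_def)
  qed
  then obtain V D where V: "(V has_real_derivative D) (at s within {0..})" "V s = W s y"
    "\<forall>\<^sub>F r in at_left s. V r \<le> W r y" "D < disc_laplace N (\<lambda>y. \<phi> (u s y)) y + k * f (u s y)"
    using touch[OF s, of y] y(2) by (auto simp: d_def)
  have "\<forall>\<^sub>F r in at_left s. r \<in> {0<..<s}" using eventually_at_left_real[OF s(1)] .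
  then have "\<forall>\<^sub>F r in at_left s. 0 < d r y"
    by eventually_elim (use before y(1) in auto)
  then have ev: "\<forall>\<^sub>F r in at_left s. 0 \<le> u r y - V r"
    using V(3) by eventually_elim (auto simp: d_def)
  have "u s y - V s = 0" using y V(2) by (simp add: d_def)
  with ev have "disc_laplace N (\<lambda>y. \<phi> (u s y)) y + k * f (u s y) - D \<le> 0"
    using left_touching_derivative[OF DERIV_diff[OF du V(1)]] s(1) by auto
  then show False using V(4) by simp
qed

lemma barrier_ge_start:
  fixes a b c k t :: real
  assumes "a \<le> b" "0 < c" "0 < k" "0 \<le> t"
  shows "a \<le> b - (b - a) * exp (- c * k * t)"
proof -
  have "exp (- c * k * t) \<le> 1" using assms by simp
  then have "(b - a) * exp (- c * k * t) \<le> (b - a) * 1" using assms by (intro mult_left_mono) auto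
  then show ?thesis by simp
qed

text \<open>The barrier that is constant in space solves \<open>y' = c k (b - y)\<close> and so relaxes from \<open>a\<close> to
  \<open>b\<close>; on the logarithmically long time scale \<open>ln k / k\<close> it comes as close to \<open>b\<close> as desired.\<close>
lemma constant_barrier:
  fixes u :: "real \<Rightarrow> int ^ 'd \<Rightarrow> real"
  assumes N: "N \<ge> 1" and u: "solves_lattice N k \<phi> f u" and k: "k > 0"
    and mono: "mono_on J \<phi>" and ab: "a < b" "{a..b} \<subseteq> J"
    and J: "\<And>t x. 0 \<le> t \<Longrightarrow> a \<le> u t x \<Longrightarrow> u t x \<in> J"
    and c: "0 < c" "\<And>r. a \<le> r \<Longrightarrow> r \<le> b \<Longrightarrow> c * (b - r) < f r"
    and init: "\<And>x. a < u 0 x" and t: "0 \<le> t"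
  shows "b - (b - a) * exp (- c * k * t) < u t x"
proof -
  define y where "y t = b - (b - a) * exp (- c * k * t)" for t
  have range: "a \<le> y t" "y t \<le> b" if "0 \<le> t" for t
    using barrier_ge_start[OF _ c(1) k that, of a b] ab by (auto simp: y_def)
  have dy: "(y has_real_derivative k * (c * (b - y t))) (at t within {0..})" for t
    unfolding y_def by (auto intro!: derivative_eq_intros)
  have "(\<lambda>x. y t) x < u t x"
  proof (rule strict_comparison[OF N u, where W = "\<lambda>t x. y t" and T = t])
    show "continuous_on {0..t} (\<lambda>t. y t)" unfolding y_def by (intro continuous_intros)
    show "y 0 < u 0 x" for x using init by (simp add: y_def)
    fix s x assume s: "0 < s" "s \<le> t" and le: "\<And>x. y s \<le> u s x" and eq: "u s x = y s"
    have "disc_laplace N (\<lambda>x. \<phi> (y s)) x \<le> disc_laplace N (\<lambda>x. \<phi> (u s x)) x"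
    proof (rule disc_laplace_mono_at)
      show "\<phi> (y s) \<le> \<phi> (u s x)" for x
      proof (rule mono_onD[OF mono])
        show "y s \<in> J" using range[of s] s ab by auto
        show "u s x \<in> J" using J[of s x] range[of s] le[of x] s by auto
      qed (rule le)
    qed (simp add: eq)
    moreover have "k * (c * (b - y s)) < k * f (u s x)"
      unfolding eq using c(2)[of "y s"] range[of s] s k by simp
    moreover have "disc_laplace N (\<lambda>x. \<phi> (y s)) x = 0" by (simp add: disc_laplace_def)
    ultimately have "k * (c * (b - y s)) < disc_laplace N (\<lambda>x. \<phi> (u s x)) x + k * f (u s x)" by simp
    then show "\<exists>V D. (V has_real_derivative D) (at s within {0..}) \<and> V s = y s \<and>
        (\<forall>\<^sub>F r in at_left s. V r \<le> y r) \<and>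
        D < disc_laplace N (\<lambda>x. \<phi> (u s x)) x + k * f (u s x)"
      using dy by (intro exI[of _ y] exI[of _ "k * (c * (b - y s))"]) auto
  qed (use t in \<open>auto simp: disc_torus_fun_def\<close>)
  then show ?thesis by (simp add: y_def)
qed

section \<open>Increments of the sampled initial datum\<close>

lemma torus_fun_bounded:
  fixes F :: "real ^ 'd \<Rightarrow> real"
  assumes per: "torus_fun F" and cont: "continuous_on UNIV F"
  obtains B where "B > 0" "\<And>v. \<bar>F v\<bar> \<le> B"
proof -
  have "compact (F ` cbox 0 1)"
    by (intro compact_continuous_image compact_cbox continuous_on_subset[OF cont]) auto
  then obtain B where B: "B > 0" "\<And>v. v \<in> cbox 0 1 \<Longrightarrow> norm (F v) \<le> B"
    using compact_imp_bounded bounded_pos by (metis imageI)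
  have "\<bar>F v\<bar> \<le> B" for v
  proof -
    define w :: "real ^ 'd" where "w = (\<chi> i. frac (v $ i))"
    have "w \<in> cbox 0 1" by (simp add: w_def mem_box_cart frac_ge_0 less_imp_le[OF frac_lt_1])
    moreover have "F v = F w"
      using per unfolding torus_fun_def by (auto simp: w_def frac_def)
    ultimately show ?thesis using B(2) by simp
  qed
  then show thesis using that B(1) by blast
qed

text \<open>Translation by an integer vector leaves \<open>F\<close>, and therefore its derivative, unchanged.\<close>
lemma torus_fun_partial:
  fixes F :: "real ^ 'd \<Rightarrow> real"
  assumes "torus_fun F"
  shows "torus_fun (\<lambda>v. frechet_derivative F (at v) b)"
  unfolding torus_fun_def
proof (intro allI impI)
  fix v w :: "real ^ 'd" assume vw: "\<forall>i. v $ i - w $ i \<in> \<int>"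
  have F: "F (z + (v - w)) = F z" for z
    using assms vw unfolding torus_fun_def by simp
  have "(F has_derivative D) (at v) \<longleftrightarrow> (F has_derivative D) (at w)" for D
  proof -
    have "(F has_derivative D) (at v) \<longleftrightarrow> ((\<lambda>h. F (h + v)) has_derivative D) (at 0)"
      using has_derivative_at_within[of F D v] by (simp add: has_derivative_at algebra_simps)
    moreover have "(F has_derivative D) (at w) \<longleftrightarrow> ((\<lambda>h. F (h + w)) has_derivative D) (at 0)"
      by (simp add: has_derivative_at algebra_simps)
    moreover have "F (h + v) = F (h + w)" for h using F[of "h + w"] by (simp add: algebra_simps)
    ultimately show ?thesis by simp
  qed
  then show "frechet_derivative F (at v) b = frechet_derivative F (at w) b"
    by (simp add: frechet_derivative_def)
qed

lemma partial_along_line: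
  fixes F :: "real ^ 'd \<Rightarrow> real"
  assumes "\<And>v. F differentiable (at v)"
  shows "((\<lambda>r. F (v + r *\<^sub>R b)) has_real_derivative frechet_derivative F (at (v + r *\<^sub>R b)) b) (at r)"
proof -
  let ?D = "frechet_derivative F (at (v + r *\<^sub>R b))"
  have D: "(F has_derivative ?D) (at (v + r *\<^sub>R b))"
    using assms frechet_derivative_works by blast
  have "((\<lambda>r. v + r *\<^sub>R b) has_vector_derivative b) (at r)"
    by (auto intro!: derivative_eq_intros)
  from vector_derivative_diff_chain_within[where S = UNIV, OF this has_derivative_at_withinI[OF D]]
  show ?thesis by (simp add: has_real_derivative_iff_has_vector_derivative o_def)
qed

text \<open>The first and second partial derivatives in the direction \<open>b\<close> are continuous and periodic, hence
  bounded.\<close>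
lemma torus_C2_line_increments:
  fixes F :: "real ^ 'd \<Rightarrow> real"
  assumes per: "torus_fun F" and F: "Ck_holder_on (Suc (Suc (Suc k))) \<theta> UNIV F" and b: "b \<in> Basis"
  shows "\<exists>L>0. \<forall>v h. \<bar>F (v + h *\<^sub>R b) - F v\<bar> \<le> L * \<bar>h\<bar> \<and>
    \<bar>F (v + h *\<^sub>R b) + F (v - h *\<^sub>R b) - 2 * F v\<bar> \<le> L * h\<^sup>2"
proof -
  define p where "p v = frechet_derivative F (at v) b" for v
  define q where "q v = frechet_derivative p (at v) b" for v
  have F1: "F differentiable (at v)" for v using F by simp
  have F2: "Ck_holder_on (Suc (Suc k)) \<theta> UNIV p" using F b unfolding p_def by simp
  then have p1: "p differentiable (at v)" for v by simp
  have "Ck_holder_on (Suc k) \<theta> UNIV q" using F2 b unfolding q_def by simp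
  then have q1: "q differentiable (at v)" for v by simp
  have per1: "torus_fun p" unfolding p_def by (rule torus_fun_partial[OF per])
  have per2: "torus_fun q" unfolding q_def by (rule torus_fun_partial[OF per1])
  have "continuous_on UNIV p" "continuous_on UNIV q"
    using p1 q1 by (auto intro!: differentiable_imp_continuous_on simp: differentiable_on_def)
  then obtain B C where B: "B > 0" "\<And>v. \<bar>p v\<bar> \<le> B" and C: "C > 0" "\<And>v. \<bar>q v\<bar> \<le> C"
    using torus_fun_bounded per1 per2 by metis
  have bounds: "\<bar>F (v + h *\<^sub>R b) - F v\<bar> \<le> (B + C) * \<bar>h\<bar> \<and>
    \<bar>F (v + h *\<^sub>R b) + F (v - h *\<^sub>R b) - 2 * F v\<bar> \<le> (B + C) * h\<^sup>2" for v h
  proof -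
    define G where "G r = F (v + r *\<^sub>R b)" for r
    define G1 where "G1 r = p (v + r *\<^sub>R b)" for r
    define G2 where "G2 r = q (v + r *\<^sub>R b)" for r
    have dG: "(G has_real_derivative G1 r) (at r)" for r
      unfolding G_def G1_def p_def by (rule partial_along_line[OF F1])
    have dG1: "(G1 has_real_derivative G2 r) (at r)" for r
      unfolding G1_def G2_def q_def by (rule partial_along_line[OF p1])
    have "norm (G h - G 0) \<le> B * norm (h - 0)"
      by (rule field_differentiable_bound[where S = UNIV and f' = G1])
         (use dG B in \<open>auto simp: G1_def\<close>)
    then have first: "\<bar>F (v + h *\<^sub>R b) - F v\<bar> \<le> B * \<bar>h\<bar>" by (simp add: G_def)
    have lower: "G 0 + G1 0 * (r - 0) - C / 2 * (r - 0)\<^sup>2 \<le> G r" for r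
      by (rule quadratic_lower_bound[where I = UNIV and F'' = G2])
         (use dG dG1 C(2) in \<open>auto simp: G2_def abs_le_iff minus_le_iff\<close>)
    have upper: "- G 0 + (- G1 0) * (r - 0) - C / 2 * (r - 0)\<^sup>2 \<le> - G r" for r
      by (rule quadratic_lower_bound[where I = UNIV and F = "\<lambda>r. - G r" and F' = "\<lambda>r. - G1 r"
            and F'' = "\<lambda>r. - G2 r"])
         (use dG dG1 C(2) in \<open>auto simp: G2_def abs_le_iff intro!: DERIV_minus\<close>)
    have "\<bar>G h + G (- h) - 2 * G 0\<bar> \<le> C * h\<^sup>2"
      using lower[of h] lower[of "- h"] upper[of h] upper[of "- h"] by (simp add: abs_le_iff)
    then have second: "\<bar>F (v + h *\<^sub>R b) + F (v - h *\<^sub>R b) - 2 * F v\<bar> \<le> C * h\<^sup>2" by (simp add: G_def)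
    have "B * \<bar>h\<bar> \<le> (B + C) * \<bar>h\<bar>" "C * h\<^sup>2 \<le> (B + C) * h\<^sup>2"
      using B C by (auto intro!: mult_right_mono)
    then show ?thesis using first second by linarith
  qed
  show ?thesis by (rule exI[of _ "B + C"]) (use bounds B C in auto)
qed

text \<open>The discrete counterpart of a \<open>C\<^sup>2\<close> bound along the coordinate axes.\<close>
definition increments_bounded :: "nat \<Rightarrow> real \<Rightarrow> (int ^ 'd \<Rightarrow> real) \<Rightarrow> bool" where
  "increments_bounded N L w \<longleftrightarrow> (\<forall>x i.
     \<bar>w (x + axis i 1) - w x\<bar> \<le> L / N \<and> \<bar>w (x - axis i 1) - w x\<bar> \<le> L / N \<and>
     \<bar>w (x + axis i 1) + w (x - axis i 1) - 2 * w x\<bar> \<le> L / (real N)\<^sup>2)"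

lemma scaled_shift:
  "scaled N (x + axis i 1) = scaled N x + (1 / real N) *\<^sub>R axis i 1"
  "scaled N (x - axis i 1) = scaled N x - (1 / real N) *\<^sub>R axis i 1"
  by (auto simp: scaled_def vec_eq_iff axis_def add_divide_distrib diff_divide_distrib)

lemma sampled_increments_bounded:
  fixes F :: "real ^ 'd \<Rightarrow> real"
  assumes per: "torus_fun F" and F: "Ck_holder_on (Suc (Suc (Suc k))) \<theta> UNIV F"
  obtains L where "L > 0" "\<And>N. increments_bounded N L (\<lambda>x. F (scaled N x))"
proof -
  have "\<forall>i. \<exists>L>0. \<forall>v h. \<bar>F (v + h *\<^sub>R axis i 1) - F v\<bar> \<le> L * \<bar>h\<bar> \<and>
    \<bar>F (v + h *\<^sub>R axis i 1) + F (v - h *\<^sub>R axis i 1) - 2 * F v\<bar> \<le> L * h\<^sup>2"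
    using torus_C2_line_increments[OF per F] by (simp add: axis_in_Basis_iff)
  then obtain l where l: "\<And>i. l i > 0"
    "\<And>i v h. \<bar>F (v + h *\<^sub>R axis i 1) - F v\<bar> \<le> l i * \<bar>h\<bar>"
    "\<And>i v h. \<bar>F (v + h *\<^sub>R axis i 1) + F (v - h *\<^sub>R axis i 1) - 2 * F v\<bar> \<le> l i * h\<^sup>2"
    by metis
  define L where "L = (\<Sum>i\<in>UNIV. l i)"
  have L: "l i \<le> L" for i unfolding L_def by (rule member_le_sum) (auto simp: less_imp_le[OF l(1)])
  have "increments_bounded N L (\<lambda>x. F (scaled N x))" for N
    unfolding increments_bounded_def
  proof (intro allI conjI)
    fix x :: "int ^ 'd" and i :: 'd
    have le: "l i / N \<le> L / N" "l i / (real N)\<^sup>2 \<le> L / (real N)\<^sup>2"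
      using L by (auto intro!: divide_right_mono)
    show "\<bar>F (scaled N (x + axis i 1)) - F (scaled N x)\<bar> \<le> L / N"
      using l(2)[of "scaled N x" "1 / real N" i] le by (simp add: scaled_shift)
    show "\<bar>F (scaled N (x - axis i 1)) - F (scaled N x)\<bar> \<le> L / N"
      using l(2)[of "scaled N x" "- (1 / real N)" i] le by (simp add: scaled_shift)
    show "\<bar>F (scaled N (x + axis i 1)) + F (scaled N (x - axis i 1)) - 2 * F (scaled N x)\<bar>
        \<le> L / (real N)\<^sup>2"
      using l(3)[of "scaled N x" "1 / real N" i] le by (simp add: scaled_shift power_divide)
  qed
  moreover have "L > 0" using l(1)[of undefined] L[of undefined] by linarith
  ultimately show thesis using that by blast
qed

section \<open>The moving barrier\<close>

text \<open>A Taylor expansion of \<open>G\<close> around \<open>\<zeta> x\<close>: the first-order terms combine into a second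
  difference of \<open>\<zeta>\<close>, and the remainder is quadratic in the first differences. Both are of
  order \<open>1 / N\<^sup>2\<close>, which the scaling of the Laplacian compensates.\<close>
lemma disc_laplace_comp_ge:
  fixes \<zeta> :: "int ^ 'd \<Rightarrow> real" and p m A :: real
  assumes N: "N \<ge> 1" and I: "convex I" "\<zeta> x \<in> I"
      "\<And>i. \<zeta> (x + axis i 1) \<in> I" "\<And>i. \<zeta> (x - axis i 1) \<in> I"
    and G: "\<And>r. r \<in> I \<Longrightarrow> (G has_real_derivative G1 r) (at r)"
      "\<And>r. r \<in> I \<Longrightarrow> (G1 has_real_derivative G2 r) (at r)"
    and p: "\<bar>G1 (\<zeta> x)\<bar> \<le> p" and m: "m \<ge> 0" "\<And>r. r \<in> I \<Longrightarrow> - m \<le> G2 r"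
    and \<zeta>: "increments_bounded N A \<zeta>"
  shows "- (CARD('d) * (p * A + m * A\<^sup>2)) \<le> disc_laplace N (\<lambda>y. G (\<zeta> y)) x"
proof -
  have N2: "real N > 0" using N by simp
  have A0: "A \<ge> 0"
  proof -
    have "0 \<le> A / N" using \<zeta> unfolding increments_bounded_def by (meson abs_ge_zero order_trans)
    then show ?thesis using N2 by (simp add: zero_le_divide_iff)
  qed
  have per_axis: "- ((p * A + m * A\<^sup>2) / (real N)\<^sup>2) \<le>
      G (\<zeta> (x + axis i 1)) + G (\<zeta> (x - axis i 1)) - 2 * G (\<zeta> x)" for i
  proof -
    define a where "a = \<zeta> (x + axis i 1) - \<zeta> x"
    define b where "b = \<zeta> (x - axis i 1) - \<zeta> x"
    have ab: "\<bar>a\<bar> \<le> A / N" "\<bar>b\<bar> \<le> A / N" "\<bar>a + b\<bar> \<le> A / (real N)\<^sup>2"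
    proof -
      show "\<bar>a\<bar> \<le> A / N" "\<bar>b\<bar> \<le> A / N" using \<zeta> by (auto simp: a_def b_def increments_bounded_def)
      have "a + b = \<zeta> (x + axis i 1) + \<zeta> (x - axis i 1) - 2 * \<zeta> x" by (simp add: a_def b_def)
      then show "\<bar>a + b\<bar> \<le> A / (real N)\<^sup>2" using \<zeta> by (simp add: increments_bounded_def)
    qed
    have 1: "G (\<zeta> x) + G1 (\<zeta> x) * a - m / 2 * a\<^sup>2 \<le> G (\<zeta> (x + axis i 1))"
      unfolding a_def by (rule quadratic_lower_bound[OF I(1,2,3) G m(2)])
    have 2: "G (\<zeta> x) + G1 (\<zeta> x) * b - m / 2 * b\<^sup>2 \<le> G (\<zeta> (x - axis i 1))"
      unfolding b_def by (rule quadratic_lower_bound[OF I(1,2,4) G m(2)])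
    have "\<bar>G1 (\<zeta> x) * (a + b)\<bar> \<le> p * (A / (real N)\<^sup>2)"
      unfolding abs_mult using p ab(3) by (intro mult_mono) auto
    then have 3: "- (p * A / (real N)\<^sup>2) \<le> G1 (\<zeta> x) * a + G1 (\<zeta> x) * b"
      by (simp add: algebra_simps)
    have "a\<^sup>2 \<le> (A / N)\<^sup>2" "b\<^sup>2 \<le> (A / N)\<^sup>2"
      using ab A0 N2 by (auto intro!: power2_le_iff_abs_le[THEN iffD2])
    then have "m / 2 * a\<^sup>2 \<le> m / 2 * (A / N)\<^sup>2" "m / 2 * b\<^sup>2 \<le> m / 2 * (A / N)\<^sup>2"
      using m(1) by (auto intro!: mult_left_mono)
    moreover have "m / 2 * (A / N)\<^sup>2 + m / 2 * (A / N)\<^sup>2 = m * A\<^sup>2 / (real N)\<^sup>2"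
      by (simp add: power_divide)
    ultimately have 4: "m / 2 * a\<^sup>2 + m / 2 * b\<^sup>2 \<le> m * A\<^sup>2 / (real N)\<^sup>2" by linarith
    have "- ((p * A + m * A\<^sup>2) / (real N)\<^sup>2) = - (p * A / (real N)\<^sup>2) - m * A\<^sup>2 / (real N)\<^sup>2"
      by (simp add: add_divide_distrib diff_divide_distrib)
    then show ?thesis using 1 2 3 4 by linarith
  qed
  have "- (CARD('d) * (p * A + m * A\<^sup>2)) = (real N)\<^sup>2 * (\<Sum>i\<in>(UNIV :: 'd set). - ((p * A + m * A\<^sup>2) / (real N)\<^sup>2))"
    using N2 by simp
  also have "\<dots> \<le> disc_laplace N (\<lambda>y. G (\<zeta> y)) x"
    unfolding disc_laplace_def by (intro mult_left_mono sum_mono per_axis) auto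
  finally show ?thesis .
qed

text \<open>Both derivatives of \<open>G = \<phi> \<circ> (s + H)\<close> are controlled by \<open>H'\<close>, since \<open>H''\<close> is a bounded multiple
  of \<open>H'\<close> above any fixed height. In the barrier every error term then carries the factor \<open>H'\<close>,
  which is also the factor gained by lowering its argument. The bound on the second derivative
  at \<open>z\<close> is in terms of \<open>H'(z0)\<close> at a nearby \<open>z0\<close>, because the Taylor remainder at a lattice
  point is evaluated towards its neighbours. The height \<open>a'\<close> below \<open>a\<close> leaves room for them.\<close>
lemma profile_composition_bounds:
  fixes \<phi> \<phi>' \<phi>'' :: "real \<Rightarrow> real"
  assumes R: "R > 0" and n: "n > 0" and phi: "C2_on J \<phi> \<phi>' \<phi>''"
    and ord: "a' < a" "a < s" "{a'..s + R} \<subseteq> J"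
  defines "zm \<equiv> profile_inv R n (a - s)"
  obtains \<epsilon> P M G1 G2 where "\<epsilon> > 0" "P \<ge> 0" "M \<ge> 0"
    "\<And>z0 z. zm \<le> z0 \<Longrightarrow> \<bar>z - z0\<bar> \<le> \<epsilon> \<Longrightarrow>
      1 + real n * z / R > 0 \<and> a' \<le> s + profile R n z \<and>
      ((\<lambda>z. \<phi> (s + profile R n z)) has_real_derivative G1 z) (at z) \<and>
      (G1 has_real_derivative G2 z) (at z) \<and> - (M * profile_deriv R n z0) \<le> G2 z"
    "\<And>z. zm \<le> z \<Longrightarrow> \<bar>G1 z\<bar> \<le> P * profile_deriv R n z"
proof -
  let ?H = "profile R n" and ?H' = "profile_deriv R n" and ?X = "\<lambda>z. 1 + real n * z / R"
  define z1 where "z1 = profile_inv R n (a' - s)"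
  have X1: "?X z1 > 0" and H1: "?H z1 = a' - s"
    unfolding z1_def using ord R by (auto intro!: profile_inv_pos profile_profile_inv n)
  have "z1 \<le> zm" unfolding z1_def zm_def using ord R n by (intro profile_inv_mono) auto
  moreover have "?H zm = a - s"
    unfolding zm_def using ord R by (auto intro!: profile_profile_inv n)
  then have "z1 \<noteq> zm" using H1 ord by auto
  ultimately have z1: "z1 < zm" by simp
  define \<epsilon> where "\<epsilon> = zm - z1"
  have eps: "\<epsilon> > 0" using z1 by (simp add: \<epsilon>_def)
  have Xmono: "?X z1 \<le> ?X z" if "z1 \<le> z" for z
    using that R by (simp add: divide_right_mono mult_left_mono)
  have Xz: "?X z > 0" if "z1 \<le> z" for z using Xmono[OF that] X1 by linarith
  have Hz: "s + ?H z \<in> {a'..s + R}" if "z1 \<le> z" for z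
    using profile_mono[OF R n X1 that] H1 profile_less[OF R n Xz[OF that]] by simp
  have dphi: "(\<phi> has_real_derivative \<phi>' r) (at r)" "(\<phi>' has_real_derivative \<phi>'' r) (at r)"
    if "r \<in> J" for r using phi that unfolding C2_on_def by auto
  have "continuous_on {a'..s + R} \<phi>'"
    by (rule DERIV_continuous_on, rule has_field_derivative_at_within, rule dphi(2)) (use ord in auto)
  moreover have "continuous_on {a'..s + R} \<phi>''"
    using phi ord(3) continuous_on_subset unfolding C2_on_def by blast
  ultimately have "bounded (\<phi>' ` {a'..s + R})" "bounded (\<phi>'' ` {a'..s + R})"
    by (auto intro!: compact_imp_bounded compact_continuous_image)
  then obtain P1 P2 where P1: "P1 > 0" "\<And>r. r \<in> {a'..s + R} \<Longrightarrow> \<bar>\<phi>' r\<bar> \<le> P1"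
    and P2: "P2 > 0" "\<And>r. r \<in> {a'..s + R} \<Longrightarrow> \<bar>\<phi>'' r\<bar> \<le> P2"
    unfolding bounded_pos by (metis imageI real_norm_def)
  define G1 where "G1 z = \<phi>' (s + ?H z) * ?H' z" for z
  define G2 where "G2 z = (\<phi>'' (s + ?H z) * ?H' z) * ?H' z
     + (- ((real n + 1) / R) * (?H' z / ?X z)) * \<phi>' (s + ?H z)" for z
  have dH: "((\<lambda>z. s + ?H z) has_real_derivative ?H' z) (at z)" if "z1 \<le> z" for z
    using DERIV_add[OF DERIV_const profile_has_derivative[OF R n Xz[OF that]], of s] by simp
  have dG: "((\<lambda>z. \<phi> (s + ?H z)) has_real_derivative G1 z) (at z)" if "z1 \<le> z" for z
    unfolding G1_def
    by (rule DERIV_chain2[where f = \<phi> and g = "\<lambda>z. s + ?H z", OF dphi(1) dH[OF that]])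
       (use Hz[OF that] ord in auto)
  have dG1: "(G1 has_real_derivative G2 z) (at z)" if "z1 \<le> z" for z
  proof -
    have "((\<lambda>z. \<phi>' (s + ?H z)) has_real_derivative \<phi>'' (s + ?H z) * ?H' z) (at z)"
      by (rule DERIV_chain2[where f = \<phi>' and g = "\<lambda>z. s + ?H z", OF dphi(2) dH[OF that]])
         (use Hz[OF that] ord in auto)
    from DERIV_mult[OF this profile_deriv_has_derivative[OF R n Xz[OF that]]]
    show ?thesis unfolding G1_def[abs_def] G2_def by simp
  qed
  define h where "h = ?H' z1"
  have hpos: "h > 0" unfolding h_def by (rule profile_deriv_pos[OF R n X1])
  have Hp: "0 < ?H' z" "?H' z \<le> h" if "z1 \<le> z" for z
    using profile_deriv_pos[OF R n Xz[OF that]] profile_deriv_antimono[OF R n X1 that]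
    by (auto simp: h_def)
  define c where "c = P2 * h + (real n + 1) / R / ?X z1 * P1"
  have c: "c \<ge> 0" using P1 P2 hpos R X1 by (simp add: c_def)
  have G2: "- (c * ?H' z) \<le> G2 z" if "z1 \<le> z" for z
  proof -
    have "\<bar>\<phi>'' (s + ?H z) * ?H' z * ?H' z\<bar> \<le> P2 * h * ?H' z"
      unfolding abs_mult using Hp[OF that] P2 Hz[OF that]
      by (intro mult_mono) auto
    moreover have "\<bar>- ((real n + 1) / R) * (?H' z / ?X z) * \<phi>' (s + ?H z)\<bar>
        \<le> (real n + 1) / R * (?H' z / ?X z1) * P1"
      unfolding abs_mult using Hp[OF that] P1 Hz[OF that] Xz[OF that] Xmono[OF that] X1 R
      by (intro mult_mono) (auto intro!: divide_left_mono)
    moreover have "c * ?H' z = P2 * h * ?H' z + (real n + 1) / R * (?H' z / ?X z1) * P1"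
      by (simp add: c_def algebra_simps)
    ultimately show ?thesis unfolding G2_def by linarith
  qed
  \<comment> \<open>\<open>H'\<close> is a power of \<open>1 + n z / R\<close> with exponent between \<open>- 2\<close> and \<open>- 1\<close>.\<close>
  have ratio: "?H' z \<le> (1 + real n * \<epsilon> / (R * ?X z1))\<^sup>2 * ?H' z0"
    if "z1 \<le> z" "z1 \<le> z0" "\<bar>z - z0\<bar> \<le> \<epsilon>" for z z0
  proof -
    define q where "q = 1 + real n * \<epsilon> / (R * ?X z1)"
    have q1: "q \<ge> 1" using eps R X1 by (simp add: q_def)
    have "?X z0 \<le> ?X z + real n * \<epsilon> / R"
    proof -
      have "real n * z0 / R \<le> real n * (z + \<epsilon>) / R"
        using that R by (intro divide_right_mono mult_left_mono) auto
      then show ?thesis by (simp add: algebra_simps add_divide_distrib)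
    qed
    also have "\<dots> \<le> ?X z + real n * \<epsilon> / (R * ?X z1) * ?X z"
    proof -
      have "real n * \<epsilon> / R = real n * \<epsilon> / (R * ?X z1) * ?X z1" using X1 by simp
      also have "\<dots> \<le> real n * \<epsilon> / (R * ?X z1) * ?X z"
        using Xmono[OF that(1)] eps R X1 by (intro mult_left_mono) auto
      finally show ?thesis by simp
    qed
    also have "\<dots> = q * ?X z" by (simp add: q_def algebra_simps)
    finally have "(q * ?X z) powr (- 1 / n - 1) \<le> ?X z0 powr (- 1 / n - 1)"
      using Xz[OF that(2)] n by (intro powr_mono2') (auto simp: field_simps)
    then have "q powr (- 1 / n - 1) * ?H' z \<le> ?H' z0"
      using q1 Xz[OF that(1)] by (simp add: powr_mult profile_deriv_def)
    moreover have "q powr (- 2) * ?H' z \<le> q powr (- 1 / n - 1) * ?H' z"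
      using q1 n Hp(1)[OF that(1)] by (intro mult_right_mono powr_mono) (auto simp: field_simps)
    ultimately have "q powr (- 2) * ?H' z \<le> ?H' z0" by linarith
    then have "q\<^sup>2 * (q powr (- 2) * ?H' z) \<le> q\<^sup>2 * ?H' z0" by (intro mult_left_mono) auto
    moreover have "q\<^sup>2 * q powr (- 2) = 1"
      using q1 by (simp add: powr_minus powr_numeral)
    ultimately show ?thesis by (simp add: q_def mult.assoc[symmetric])
  qed
  define M where "M = c * (1 + real n * \<epsilon> / (R * ?X z1))\<^sup>2"
  show thesis
  proof (rule that[of \<epsilon> P1 M G1 G2])
    show "M \<ge> 0" using c by (simp add: M_def)
    fix z0 z assume z: "zm \<le> z0" "\<bar>z - z0\<bar> \<le> \<epsilon>"
    then have le: "z1 \<le> z0" "z1 \<le> z" using z1 by (auto simp: \<epsilon>_def)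
    have "c * ?H' z \<le> M * ?H' z0"
      using mult_left_mono[OF ratio[OF le(2,1) z(2)] c] by (simp add: M_def mult.assoc)
    then have "- (M * ?H' z0) \<le> G2 z" using G2[OF le(2)] by linarith
    then show "1 + real n * z / R > 0 \<and> a' \<le> s + profile R n z \<and>
      ((\<lambda>z. \<phi> (s + profile R n z)) has_real_derivative G1 z) (at z) \<and>
      (G1 has_real_derivative G2 z) (at z) \<and> - (M * profile_deriv R n z0) \<le> G2 z"
      using Xz[OF le(2)] Hz[OF le(2)] dG[OF le(2)] dG1[OF le(2)] by auto
  next
    fix z assume "zm \<le> z"
    then have "z1 \<le> z" using z1 by simp
    then show "\<bar>G1 z\<bar> \<le> P1 * ?H' z"
      unfolding G1_def abs_mult using P1(2)[OF Hz] Hp(1)[of z] P1(1) by (intro mult_mono) auto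
  qed (use eps P1 in auto)
qed

text \<open>The barrier is \<open>s + H(\<zeta>)\<close> with \<open>\<zeta>(t, x) = E (u(0, x) - s - (C / k) E)\<close> and
  \<open>E = exp (\<gamma> k t)\<close>, cut off at the height \<open>a\<close>, below which the solution is known not to go.
  Its time derivative is \<open>H'(\<zeta>) (\<gamma> k \<zeta> - \<gamma> C E\<^sup>2)\<close>. The term with \<open>k\<close> is dominated by the
  reaction, by the choice of the profile. The discrete Laplacian is at least \<open>- Q H'(\<zeta>) E\<^sup>2\<close>,
  since differences of \<open>\<zeta>\<close> are \<open>E\<close> times those of the initial datum; this fixes \<open>C\<close>. The Taylor
  expansion needs neighbouring values of \<open>\<zeta>\<close> to be close, that is, \<open>E L / N\<close> to be small.\<close>
lemma interface_lower_bound: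
  fixes \<phi> \<phi>' \<phi>'' f :: "real \<Rightarrow> real"
  assumes R: "R > 0" and n: "n > 0" and phi: "C2_on J \<phi> \<phi>' \<phi>''" and mono: "mono_on J \<phi>"
    and ord: "a' < a" "a < s" "{a'..s + R} \<subseteq> J"
    and \<gamma>: "\<gamma> > 0"
    and speed: "\<And>z. 1 + real n * z / R > 0 \<Longrightarrow> a \<le> s + profile R n z \<Longrightarrow>
      \<gamma> * (z * profile_deriv R n z) \<le> f (s + profile R n z)"
    and L: "L > 0"
  obtains \<epsilon> C where "\<epsilon> > 0" "C > 0"
    "\<And>N k (u :: real \<Rightarrow> int ^ 'd \<Rightarrow> real) t x z. N \<ge> 1 \<Longrightarrow> k > 0 \<Longrightarrow> solves_lattice N k \<phi> f u \<Longrightarrow>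
      (\<And>t x. 0 \<le> t \<Longrightarrow> a < u t x \<and> u t x \<in> J) \<Longrightarrow> increments_bounded N L (u 0) \<Longrightarrow> 0 \<le> t \<Longrightarrow>
      exp (\<gamma> * k * t) * L / N \<le> \<epsilon> \<Longrightarrow> 1 + real n * z / R > 0 \<Longrightarrow>
      z \<le> exp (\<gamma> * k * t) * (u 0 x - s - C / k * exp (\<gamma> * k * t)) \<Longrightarrow> s + profile R n z < u t x"
proof -
  let ?H = "profile R n" and ?H' = "profile_deriv R n" and ?X = "\<lambda>z. 1 + real n * z / R"
  define zm where "zm = profile_inv R n (a - s)"
  have as: "a - s < R" using ord R by simp
  have Hm: "s + ?H zm = a" and Xm: "?X zm > 0"
    unfolding zm_def using profile_profile_inv[OF R n as] profile_inv_pos[OF R n as] by auto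
  have Xz: "?X z > 0" if "zm \<le> z" for z
  proof -
    have "?X zm \<le> ?X z" using that R by (simp add: divide_right_mono mult_left_mono)
    then show ?thesis using Xm by linarith
  qed
  obtain \<epsilon> P M G1 G2 where eps: "\<epsilon> > 0" and P: "P \<ge> 0" and M: "M \<ge> 0"
    and near: "\<And>z0 z. zm \<le> z0 \<Longrightarrow> \<bar>z - z0\<bar> \<le> \<epsilon> \<Longrightarrow>
      ?X z > 0 \<and> a' \<le> s + ?H z \<and>
      ((\<lambda>z. \<phi> (s + ?H z)) has_real_derivative G1 z) (at z) \<and>
      (G1 has_real_derivative G2 z) (at z) \<and> - (M * ?H' z0) \<le> G2 z"
    and G1: "\<And>z. zm \<le> z \<Longrightarrow> \<bar>G1 z\<bar> \<le> P * ?H' z"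
    using profile_composition_bounds[OF R n phi ord] unfolding zm_def by blast
  define Q where "Q = CARD('d) * (P * L + M * L\<^sup>2)"
  have Q: "Q \<ge> 0" using P M L by (simp add: Q_def)
  \<comment> \<open>The summand \<open>1\<close> makes the differential inequality strict.\<close>
  define C where "C = (Q + 1) / \<gamma>"
  have C: "C > 0" using Q \<gamma> by (simp add: C_def)
  show thesis
  proof (rule that[OF eps C])
    fix N k and u :: "real \<Rightarrow> int ^ 'd \<Rightarrow> real" and t x z
    assume N: "N \<ge> 1" and k: "k > 0" and u: "solves_lattice N k \<phi> f u"
      and uJ: "\<And>t x. 0 \<le> t \<Longrightarrow> a < u t x \<and> u t x \<in> J" and inc: "increments_bounded N L (u 0)"
      and t: "0 \<le> t" and small: "exp (\<gamma> * k * t) * L / N \<le> \<epsilon>" and z: "?X z > 0"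
      and zle: "z \<le> exp (\<gamma> * k * t) * (u 0 x - s - C / k * exp (\<gamma> * k * t))"
    define E where "E t = exp (\<gamma> * k * t)" for t
    define \<zeta> where "\<zeta> t x = E t * (u 0 x - s - C / k * E t)" for t x
    define W where "W t x = s + ?H (max zm (\<zeta> t x))" for t x
    have per: "disc_torus_fun N (u 0)" using u unfolding solves_lattice_def by simp
    have d\<zeta>: "((\<lambda>t. \<zeta> t x) has_real_derivative \<gamma> * k * \<zeta> t x - \<gamma> * C * (E t)\<^sup>2) (at t within S)" for t x S
      unfolding \<zeta>_def E_def using k
      by (auto intro!: derivative_eq_intros simp: algebra_simps power2_eq_square)
    have "W t x < u t x"
    proof (rule strict_comparison[OF N u, where T = t])
      show "disc_torus_fun N (W r)" for r
        unfolding disc_torus_fun_def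
      proof (intro allI impI)
        fix x y :: "int ^ 'd" assume "\<forall>i. [x $ i = y $ i] (mod int N)"
        then have "u 0 x = u 0 y" using per unfolding disc_torus_fun_def by blast
        then show "W r x = W r y" by (simp add: W_def \<zeta>_def)
      qed
      show "continuous_on {0..t} (\<lambda>t. W t x)" for x
      proof -
        have c: "continuous_on {zm..} ?H"
          using profile_has_derivative[OF R n Xz]
          by (intro DERIV_continuous_on) (auto intro: has_field_derivative_at_within)
        have "continuous_on {0..t} (\<lambda>t. max zm (\<zeta> t x))"
          unfolding \<zeta>_def E_def by (intro continuous_intros)
        then show ?thesis unfolding W_def
          by (intro continuous_on_add continuous_on_const continuous_on_compose2[OF c]) auto
      qed
      show "W 0 x < u 0 x" for x
      proof (cases "\<zeta> 0 x \<le> zm")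
        case True
        then show ?thesis using uJ[of 0 x] Hm by (simp add: W_def)
      next
        case False
        then have "?H (max zm (\<zeta> 0 x)) \<le> \<zeta> 0 x"
          using profile_le_id[OF R n Xz, of "\<zeta> 0 x"] by (simp add: max_def)
        also have "\<dots> < u 0 x - s" using C k by (simp add: \<zeta>_def E_def)
        finally show ?thesis by (simp add: W_def)
      qed
    next
      fix r x assume r: "0 < r" "r \<le> t" and le: "\<And>y. W r y \<le> u r y" and eq: "u r x = W r x"
      define z0 where "z0 = \<zeta> r x"
      \<comment> \<open>There is no contact where the barrier is cut off, since \<open>u > a\<close>.\<close>
      have z0: "zm < z0"
      proof (rule ccontr)
        assume "\<not> zm < z0"
        then have "W r x = a" using Hm by (simp add: W_def z0_def max_def)
        then show False using uJ[of r x] eq r by simp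
      qed
      then have Wx: "W r x = s + ?H z0" by (simp add: W_def z0_def)
      have Er: "0 < E r" "1 \<le> E r" "E r \<le> E t" using r k \<gamma> by (auto simp: E_def)
      have diff: "\<zeta> r y - \<zeta> r y' = E r * (u 0 y - u 0 y')" for y y'
        by (simp add: \<zeta>_def algebra_simps)
      have inc\<zeta>: "increments_bounded N (E r * L) (\<zeta> r)"
        unfolding increments_bounded_def
      proof (intro allI conjI)
        fix y :: "int ^ 'd" and i :: 'd
        have "\<bar>\<zeta> r (y + axis i 1) - \<zeta> r y\<bar> = E r * \<bar>u 0 (y + axis i 1) - u 0 y\<bar>"
          unfolding diff abs_mult using Er by simp
        also have "\<dots> \<le> E r * (L / N)"
          using inc Er unfolding increments_bounded_def by (intro mult_left_mono) auto
        finally show "\<bar>\<zeta> r (y + axis i 1) - \<zeta> r y\<bar> \<le> E r * L / N" by simp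
        have "\<bar>\<zeta> r (y - axis i 1) - \<zeta> r y\<bar> = E r * \<bar>u 0 (y - axis i 1) - u 0 y\<bar>"
          unfolding diff abs_mult using Er by simp
        also have "\<dots> \<le> E r * (L / N)"
          using inc Er unfolding increments_bounded_def by (intro mult_left_mono) auto
        finally show "\<bar>\<zeta> r (y - axis i 1) - \<zeta> r y\<bar> \<le> E r * L / N" by simp
        have "\<zeta> r (y + axis i 1) + \<zeta> r (y - axis i 1) - 2 * \<zeta> r y
           = E r * (u 0 (y + axis i 1) + u 0 (y - axis i 1) - 2 * u 0 y)"
          by (simp add: \<zeta>_def algebra_simps)
        then have "\<bar>\<zeta> r (y + axis i 1) + \<zeta> r (y - axis i 1) - 2 * \<zeta> r y\<bar>
           = E r * \<bar>u 0 (y + axis i 1) + u 0 (y - axis i 1) - 2 * u 0 y\<bar>"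
          using Er by (simp add: abs_mult)
        also have "\<dots> \<le> E r * (L / (real N)\<^sup>2)"
          using inc Er unfolding increments_bounded_def by (intro mult_left_mono) auto
        finally show "\<bar>\<zeta> r (y + axis i 1) + \<zeta> r (y - axis i 1) - 2 * \<zeta> r y\<bar> \<le> E r * L / (real N)\<^sup>2"
          by simp
      qed
      have "E r * L / N \<le> E t * L / N"
        using Er L by (intro divide_right_mono mult_right_mono) auto
      then have small': "E r * L / N \<le> \<epsilon>" using small by (simp add: E_def)
      define I where "I = {z0 - \<epsilon>..z0 + \<epsilon>}"
      have I: "\<zeta> r x \<in> I" "\<zeta> r (x + axis i 1) \<in> I" "\<zeta> r (x - axis i 1) \<in> I" for i
      proof -
        have "\<bar>\<zeta> r (x + axis i 1) - \<zeta> r x\<bar> \<le> \<epsilon>" "\<bar>\<zeta> r (x - axis i 1) - \<zeta> r x\<bar> \<le> \<epsilon>"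
          using inc\<zeta> small' unfolding increments_bounded_def by (meson order_trans)+
        then show "\<zeta> r x \<in> I" "\<zeta> r (x + axis i 1) \<in> I" "\<zeta> r (x - axis i 1) \<in> I"
          using eps by (auto simp: I_def z0_def)
      qed
      have nearI: "?X y > 0 \<and> a' \<le> s + ?H y \<and>
          ((\<lambda>z. \<phi> (s + ?H z)) has_real_derivative G1 y) (at y) \<and>
          (G1 has_real_derivative G2 y) (at y) \<and> - (M * ?H' z0) \<le> G2 y" if "y \<in> I" for y
        using near[of z0 y] z0 that by (auto simp: I_def)
      have H'0: "?H' z0 > 0" using profile_deriv_pos[OF R n Xz] z0 by simp
      have "- (CARD('d) * (P * ?H' z0 * (E r * L) + M * ?H' z0 * (E r * L)\<^sup>2))
          \<le> disc_laplace N (\<lambda>y. \<phi> (s + ?H (\<zeta> r y))) x"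
      proof (rule disc_laplace_comp_ge[where I = I and \<zeta> = "\<zeta> r" and G = "\<lambda>z. \<phi> (s + ?H z)"])
        show "\<bar>G1 (\<zeta> r x)\<bar> \<le> P * ?H' z0" using G1[of z0] z0 by (simp add: z0_def)
        show "0 \<le> M * ?H' z0" using M H'0 by simp
      qed (use N I nearI inc\<zeta> in \<open>auto simp: I_def\<close>)
      also have "\<dots> \<le> disc_laplace N (\<lambda>y. \<phi> (u r y)) x"
      proof -
        have nb: "\<phi> (s + ?H (\<zeta> r y)) \<le> \<phi> (u r y)" if y: "\<zeta> r y \<in> I" for y
        proof (rule mono_onD[OF mono])
          have X: "?X (\<zeta> r y) > 0" and a': "a' \<le> s + ?H (\<zeta> r y)" using nearI[OF y] by auto
          show "s + ?H (\<zeta> r y) \<in> J" using a' profile_less[OF R n X] ord(3) by auto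
          show "u r y \<in> J" using uJ r by simp
          have "?H (\<zeta> r y) \<le> ?H (max zm (\<zeta> r y))" by (rule profile_mono[OF R n X]) simp
          then show "s + ?H (\<zeta> r y) \<le> u r y" using le[of y] by (simp add: W_def)
        qed
        have "\<phi> (s + ?H (\<zeta> r x)) = \<phi> (u r x)" using eq Wx by (simp add: z0_def)
        then show ?thesis unfolding disc_laplace_def using nb I
          by (intro mult_left_mono sum_mono diff_mono add_mono) auto
      qed
      finally have lap: "- (CARD('d) * (P * ?H' z0 * (E r * L) + M * ?H' z0 * (E r * L)\<^sup>2))
          \<le> disc_laplace N (\<lambda>y. \<phi> (u r y)) x" .
      have "CARD('d) * (P * ?H' z0 * (E r * L) + M * ?H' z0 * (E r * L)\<^sup>2) \<le> Q * (?H' z0 * (E r)\<^sup>2)"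
      proof -
        have "E r \<le> (E r)\<^sup>2" using Er by (simp add: self_le_power)
        then have "P * ?H' z0 * (E r * L) \<le> P * ?H' z0 * ((E r)\<^sup>2 * L)"
          using P H'0 L by (intro mult_left_mono mult_right_mono) auto
        then have "CARD('d) * (P * ?H' z0 * (E r * L) + M * ?H' z0 * (E r * L)\<^sup>2)
            \<le> CARD('d) * (P * ?H' z0 * ((E r)\<^sup>2 * L) + M * ?H' z0 * (E r * L)\<^sup>2)"
          by (rule mult_left_mono[OF add_right_mono]) simp
        also have "\<dots> = Q * (?H' z0 * (E r)\<^sup>2)"
          by (simp add: Q_def algebra_simps power_mult_distrib)
        finally show ?thesis .
      qed
      also have "\<dots> < (Q + 1) * (?H' z0 * (E r)\<^sup>2)" using H'0 Er by simp
      also have "\<dots> = \<gamma> * C * (E r)\<^sup>2 * ?H' z0" using \<gamma> by (simp add: C_def)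
      finally have lap': "- (\<gamma> * C * (E r)\<^sup>2 * ?H' z0) < disc_laplace N (\<lambda>y. \<phi> (u r y)) x"
        using lap by linarith
      have "a \<le> s + ?H z0" using uJ[of r x] eq Wx r by simp
      from speed[OF Xz this] z0 have "\<gamma> * (z0 * ?H' z0) \<le> f (u r x)" using eq Wx by simp
      then have react: "k * (\<gamma> * (z0 * ?H' z0)) \<le> k * f (u r x)" using k by simp
      define D where "D = ?H' z0 * (\<gamma> * k * z0 - \<gamma> * C * (E r)\<^sup>2)"
      have "D = k * (\<gamma> * (z0 * ?H' z0)) - \<gamma> * C * (E r)\<^sup>2 * ?H' z0" by (simp add: D_def algebra_simps)
      then have Dless: "D < disc_laplace N (\<lambda>y. \<phi> (u r y)) x + k * f (u r x)"
        using lap' react by linarith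
      have dV: "((\<lambda>t. s + ?H (\<zeta> t x)) has_real_derivative D) (at r within {0..})"
      proof -
        have "((\<lambda>t. ?H (\<zeta> t x)) has_real_derivative D) (at r within {0..})"
          unfolding D_def z0_def
          by (rule DERIV_chain2[where f = ?H and g = "\<lambda>t. \<zeta> t x", OF profile_has_derivative[OF R n Xz] d\<zeta>])
             (use z0 in \<open>simp add: z0_def\<close>)
        from DERIV_add[OF DERIV_const this, of s] show ?thesis by simp
      qed
      have "((\<lambda>t. \<zeta> t x) \<longlongrightarrow> \<zeta> r x) (at_left r)"
        using DERIV_continuous[OF d\<zeta>] unfolding continuous_within by blast
      then have "\<forall>\<^sub>F t in at_left r. zm < \<zeta> t x"
        using z0 by (intro order_tendstoD(1)) (auto simp: z0_def)
      then have "\<forall>\<^sub>F t in at_left r. s + ?H (\<zeta> t x) \<le> W t x"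
        by eventually_elim (simp add: W_def)
      then show "\<exists>V D. (V has_real_derivative D) (at r within {0..}) \<and> V r = W r x \<and>
        (\<forall>\<^sub>F q in at_left r. V q \<le> W q x) \<and>
        D < disc_laplace N (\<lambda>y. \<phi> (u r y)) x + k * f (u r x)"
        using dV Dless Wx by (intro exI[of _ "\<lambda>t. s + ?H (\<zeta> t x)"] exI[of _ D]) (auto simp: z0_def)
    qed (use uJ t in auto)
    moreover have "?H z \<le> ?H (max zm (\<zeta> t x))"
      by (rule profile_mono[OF R n z]) (use zle in \<open>simp add: \<zeta>_def E_def\<close>)
    ultimately show "s + ?H z < u t x" by (simp add: W_def)
  qed
qed

section \<open>Generation of the interface from below\<close>

lemma positive_on_compact_lower_bound:
  fixes F :: "real \<Rightarrow> real"
  assumes "continuous_on {c..d} F" "\<And>r. r \<in> {c..d} \<Longrightarrow> 0 < F r"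
  obtains m where "m > 0" "\<And>r. r \<in> {c..d} \<Longrightarrow> m \<le> F r"
proof (cases "c \<le> d")
  case True
  then obtain x where "x \<in> {c..d}" "\<And>r. r \<in> {c..d} \<Longrightarrow> F x \<le> F r"
    using continuous_attains_inf[of "{c..d}" F] assms(1) by auto
  then show thesis using that[of "F x"] assms(2) by blast
next
  case False
  then show thesis using that[of 1] by simp
qed

lemma C2_on_continuous:
  assumes "C2_on J F F' F''" "S \<subseteq> J"
  shows "continuous_on S F"
  by (rule DERIV_continuous_on[where D = F'], rule has_field_derivative_at_within)
     (use assms in \<open>auto simp: C2_on_def\<close>)

lemma unstable_zero_growth:
  fixes f f' f'' :: "real \<Rightarrow> real"
  assumes f: "C2_on J f f' f''" and ord: "a < s" "R > 0" "{a..s + R} \<subseteq> J"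
    and zero: "f s = 0" "f' s = \<gamma>" and \<gamma>: "\<gamma> > 0"
    and pos: "\<And>r. s < r \<Longrightarrow> r \<le> s + R \<Longrightarrow> 0 < f r"
  obtains B m where "B > 0" "m > 0"
    "\<And>y. a \<le> s + y \<Longrightarrow> y \<le> R \<Longrightarrow> \<gamma> * y - B * y\<^sup>2 \<le> f (s + y)"
    "\<And>y. \<gamma> / (2 * B) \<le> y \<Longrightarrow> y \<le> R \<Longrightarrow> m \<le> f (s + y)"
proof -
  have "continuous_on {a..s + R} f''"
    using f ord(3) continuous_on_subset unfolding C2_on_def by blast
  then have "bounded (f'' ` {a..s + R})" by (auto intro!: compact_imp_bounded compact_continuous_image)
  then obtain b where b: "b > 0" "\<And>r. r \<in> {a..s + R} \<Longrightarrow> \<bar>f'' r\<bar> \<le> b"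
    unfolding bounded_pos by (metis imageI real_norm_def)
  have quad: "\<gamma> * y - b / 2 * y\<^sup>2 \<le> f (s + y)" if "a \<le> s + y" "y \<le> R" for y
  proof -
    have "f s + f' s * ((s + y) - s) - b / 2 * ((s + y) - s)\<^sup>2 \<le> f (s + y)"
    proof (rule quadratic_lower_bound[where I = "{a..s + R}"])
      show "- b \<le> f'' r" if "r \<in> {a..s + R}" for r using b(2)[OF that] by linarith
    qed (use f ord that in \<open>auto simp: C2_on_def\<close>)
    then show ?thesis using zero by simp
  qed
  define c where "c = \<gamma> / (2 * (b / 2))"
  have "c > 0" using \<gamma> b by (simp add: c_def)
  then have "{s + c..s + R} \<subseteq> J" "\<And>r. r \<in> {s + c..s + R} \<Longrightarrow> 0 < f r"
    using ord pos by auto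
  then obtain m where m: "m > 0" "\<And>r. r \<in> {s + c..s + R} \<Longrightarrow> m \<le> f r"
    using positive_on_compact_lower_bound[OF C2_on_continuous[OF f]] by blast
  show thesis
    by (rule that[of "b / 2" m]) (use b m quad in \<open>auto simp: c_def\<close>)
qed

lemma relaxation_rate:
  fixes f :: "real \<Rightarrow> real"
  assumes "continuous_on {a..b} f" "a < b" "\<And>r. a \<le> r \<Longrightarrow> r \<le> b \<Longrightarrow> 0 < f r"
  obtains c where "c > 0" "\<And>r. a \<le> r \<Longrightarrow> r \<le> b \<Longrightarrow> c * (b - r) < f r"
proof -
  obtain m where m: "m > 0" "\<And>r. r \<in> {a..b} \<Longrightarrow> m \<le> f r"
    using positive_on_compact_lower_bound[OF assms(1)] assms(3) by auto
  define c where "c = m / (2 * (b - a))"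
  have c: "c > 0" using m assms(2) by (simp add: c_def)
  have "c * (b - r) < f r" if "a \<le> r" "r \<le> b" for r
  proof -
    have "c * (b - r) \<le> c * (b - a)" using c that by (intro mult_left_mono) auto
    also have "\<dots> = m / 2" using assms(2) by (simp add: c_def field_simps)
    also have "\<dots> < m" using m by simp
    finally show ?thesis using m(2)[of r] that by simp
  qed
  then show thesis using c that by blast
qed

text \<open>At the time \<open>t = ln k / (2 \<gamma> k)\<close> the factor \<open>exp (\<gamma> k t)\<close> equals \<open>\<surd>k\<close>. Hence an initial
  excess \<open>M / \<surd>k\<close> over the unstable zero has been amplified to \<open>M\<close>, the correction
  \<open>(C / k) exp (\<gamma> k t)\<close> is amplified to the constant \<open>C\<close>, and \<open>M\<close> can be chosen so that the profile
  is within \<open>\<eta>\<close> of its limit \<open>R\<close> at \<open>M - C\<close>. The spatially constant barrier supplies both the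
  height at which the moving barrier is cut off and the lower bound away from the interface.\<close>
lemma interface_generation_lower:
  fixes \<phi> \<phi>' \<phi>'' f f' f'' :: "real \<Rightarrow> real" and u :: "nat \<Rightarrow> real \<Rightarrow> int ^ 'd \<Rightarrow> real"
    and K :: "nat \<Rightarrow> real"
  assumes phi: "C2_on J \<phi> \<phi>' \<phi>''" and mono: "mono_on J \<phi>" and f: "C2_on J f f' f''"
    and ord: "a' < a" "a < b" "b < s" "R > 0" "{a'..s + R} \<subseteq> J"
    and zero: "f s = 0" "f' s = \<gamma>" "\<gamma> > 0"
    and pos_above: "\<And>r. s < r \<Longrightarrow> r \<le> s + R \<Longrightarrow> 0 < f r"
    and pos_below: "\<And>r. a \<le> r \<Longrightarrow> r \<le> b \<Longrightarrow> 0 < f r"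
    and K: "filterlim K at_top sequentially" "(\<lambda>N. sqrt (K N) / real N) \<longlonglongrightarrow> 0"
    and L: "L > 0" and \<eta>: "\<eta> > 0"
    and sol: "\<forall>\<^sub>F N in sequentially. solves_lattice N (K N) \<phi> f (u N) \<and>
      (\<forall>t\<ge>0. \<forall>x. u N t x \<in> J) \<and> (\<forall>x. a < u N 0 x) \<and> increments_bounded N L (u N 0)"
  shows "\<exists>M>0. \<forall>\<^sub>F N in sequentially. \<forall>x.
     b - \<eta> \<le> u N (1 / (2 * \<gamma> * K N) * ln (K N)) x \<and>
     (s + M * K N powr (-1/2) \<le> u N 0 x \<longrightarrow> s + R - \<eta> \<le> u N (1 / (2 * \<gamma> * K N) * ln (K N)) x)"
proof -
  have "{a..b} \<subseteq> J" "{a..s + R} \<subseteq> J" using ord by auto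
  then obtain c where c: "c > 0" and cf: "\<And>r. a \<le> r \<Longrightarrow> r \<le> b \<Longrightarrow> c * (b - r) < f r"
    using relaxation_rate[OF C2_on_continuous[OF f]] ord(2) pos_below by blast
  have "a < s" using ord by simp
  obtain B m' where B: "B > 0" and m': "m' > 0"
    and quad: "\<And>y. a \<le> s + y \<Longrightarrow> y \<le> R \<Longrightarrow> \<gamma> * y - B * y\<^sup>2 \<le> f (s + y)"
    and away: "\<And>y. \<gamma> / (2 * B) \<le> y \<Longrightarrow> y \<le> R \<Longrightarrow> m' \<le> f (s + y)"
    using unstable_zero_growth[OF f \<open>a < s\<close> ord(4) \<open>{a..s + R} \<subseteq> J\<close> zero pos_above] by blast
  obtain n where n: "n > 0" and slow: "\<And>z. 1 + real n * z / R > 0 \<Longrightarrow>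
     (profile R n z \<le> \<gamma> / (2 * B) \<longrightarrow>
        \<gamma> * (z * profile_deriv R n z) \<le> \<gamma> * profile R n z - B * (profile R n z)\<^sup>2) \<and>
     (profile R n z \<ge> 0 \<longrightarrow> \<gamma> * (z * profile_deriv R n z) \<le> m')"
    using profile_slow[OF ord(4) zero(3) B m'] by blast
  have speed: "\<gamma> * (z * profile_deriv R n z) \<le> f (s + profile R n z)"
    if z: "1 + real n * z / R > 0" "a \<le> s + profile R n z" for z
  proof (cases "profile R n z \<le> \<gamma> / (2 * B)")
    case True
    then show ?thesis using slow[OF z(1)] quad[OF z(2)] profile_less[OF ord(4) n z(1)] by linarith
  next
    case False
    moreover have "0 < \<gamma> / (2 * B)" using zero B by simp
    ultimately show ?thesis
      using slow[OF z(1)] away[of "profile R n z"] profile_less[OF ord(4) n z(1)] by linarith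
  qed
  obtain \<epsilon> C where eps: "\<epsilon> > 0" and C: "C > 0" and interface:
    "\<And>N k (u :: real \<Rightarrow> int ^ 'd \<Rightarrow> real) t x z. N \<ge> 1 \<Longrightarrow> k > 0 \<Longrightarrow> solves_lattice N k \<phi> f u \<Longrightarrow>
      (\<And>t x. 0 \<le> t \<Longrightarrow> a < u t x \<and> u t x \<in> J) \<Longrightarrow> increments_bounded N L (u 0) \<Longrightarrow> 0 \<le> t \<Longrightarrow>
      exp (\<gamma> * k * t) * L / N \<le> \<epsilon> \<Longrightarrow> 1 + real n * z / R > 0 \<Longrightarrow>
      z \<le> exp (\<gamma> * k * t) * (u 0 x - s - C / k * exp (\<gamma> * k * t)) \<Longrightarrow> s + profile R n z < u t x"
    using interface_lower_bound[OF ord(4) n phi mono ord(1) \<open>a < s\<close> ord(5) zero(3) speed L] by blast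
  define z where "z = profile_inv R n (R - \<eta>)"
  have z: "1 + real n * z / R > 0" "profile R n z = R - \<eta>"
    unfolding z_def using \<eta> ord(4) n by (auto intro!: profile_inv_pos profile_profile_inv)
  define M where "M = \<bar>z\<bar> + C"
  have M: "M > 0" using C by (simp add: M_def add_nonneg_pos)
  have "\<forall>\<^sub>F N in sequentially. K N \<ge> 1" using K(1) by (simp add: filterlim_at_top)
  moreover have "\<forall>\<^sub>F N in sequentially. (b - a) * K N powr (- (c / (2 * \<gamma>))) < \<eta>"
  proof -
    have "((\<lambda>N. K N powr (- (c / (2 * \<gamma>)))) \<longlongrightarrow> 0) sequentially"
      using K(1) c zero by (intro tendsto_neg_powr) auto
    then have "((\<lambda>N. (b - a) * K N powr (- (c / (2 * \<gamma>)))) \<longlongrightarrow> 0) sequentially"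
      by (rule tendsto_mult_right_zero)
    then show ?thesis using \<eta> by (rule order_tendstoD(2))
  qed
  moreover have "\<forall>\<^sub>F N in sequentially. sqrt (K N) / real N < \<epsilon> / L"
    using K(2) eps L by (intro order_tendstoD(2)) auto
  moreover have "\<forall>\<^sub>F N in sequentially. N \<ge> (1 :: nat)" by (rule eventually_ge_at_top)
  ultimately have "\<forall>\<^sub>F N in sequentially. \<forall>x.
     b - \<eta> \<le> u N (1 / (2 * \<gamma> * K N) * ln (K N)) x \<and>
     (s + M * K N powr (-1/2) \<le> u N 0 x \<longrightarrow> s + R - \<eta> \<le> u N (1 / (2 * \<gamma> * K N) * ln (K N)) x)"
    using sol
  proof eventually_elim
    case (elim N)
    define k where "k = K N"
    define t where "t = 1 / (2 * \<gamma> * k) * ln k"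
    have k: "k \<ge> 1" and N: "N \<ge> 1" and u: "solves_lattice N k \<phi> f (u N)"
      and inc: "increments_bounded N L (u N 0)" using elim by (auto simp: k_def)
    have t: "t \<ge> 0" using k zero by (simp add: t_def)
    have barrier: "b - (b - a) * exp (- c * k * r) < u N r x" if "0 \<le> r" for r x
      by (rule constant_barrier[OF N u _ mono ord(2) _ _ c cf _ that])
         (use elim k \<open>{a..b} \<subseteq> J\<close> in auto)
    have above: "a < u N r x \<and> u N r x \<in> J" if "0 \<le> r" for r x
      using barrier_ge_start[OF _ c _ that, of a b k] barrier[OF that, of x] ord k elim that by auto
    have "- c * k * t = - (c / (2 * \<gamma>)) * ln k" using k zero by (simp add: t_def)
    then have "exp (- c * k * t) = k powr (- (c / (2 * \<gamma>)))" using k by (simp add: powr_def)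
    then have low: "b - \<eta> \<le> u N t x" for x
      using barrier[OF t, of x] elim by (simp add: k_def)
    have "\<gamma> * k * t = ln (sqrt k)" using k zero by (simp add: t_def ln_sqrt)
    then have E: "exp (\<gamma> * k * t) = sqrt k" using k by simp
    have high: "s + R - \<eta> \<le> u N t x" if x: "s + M * k powr (-1/2) \<le> u N 0 x" for x
    proof -
      have "sqrt k * (M * k powr (-1/2)) = M"
        using k by (simp add: powr_half_sqrt[symmetric] powr_add[symmetric] mult.left_commute)
      moreover have "sqrt k * (C / k * sqrt k) = C"
      proof -
        have "sqrt k * (C / k * sqrt k) = C / k * (sqrt k * sqrt k)" by simp
        then show ?thesis using k by simp
      qed
      moreover have "sqrt k * (M * k powr (-1/2)) \<le> sqrt k * (u N 0 x - s)"
        using x k by (intro mult_left_mono) auto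
      moreover have "sqrt k * (u N 0 x - s - C / k * sqrt k) =
          sqrt k * (u N 0 x - s) - sqrt k * (C / k * sqrt k)" by (rule right_diff_distrib)
      ultimately have "z \<le> sqrt k * (u N 0 x - s - C / k * sqrt k)"
        unfolding M_def by linarith
      moreover have "sqrt k * L / N \<le> \<epsilon>"
        using elim N L by (simp add: k_def field_simps)
      ultimately have "s + profile R n z < u N t x"
        using interface[OF N _ u above inc t _ z(1)] k unfolding E by auto
      then show ?thesis using z by simp
    qed
    show ?case using low high unfolding t_def k_def by blast
  qed
  then show ?thesis using M by blast
qed

section \<open>The bistable equation\<close>

lemma smooth_halfline_C2:
  assumes "smooth_halfline F"
  obtains F' F'' where "C2_on {0<..} F F' F''" "continuous_on {0..} F"
    "\<And>r. r > 0 \<Longrightarrow> deriv F r = F' r"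
proof -
  obtain D :: "nat \<Rightarrow> real \<Rightarrow> real" where D0: "\<And>r. r \<ge> 0 \<Longrightarrow> D 0 r = F r"
    and D: "\<And>n r. r \<ge> 0 \<Longrightarrow> (D n has_real_derivative D (Suc n) r) (at r within {0..})"
    using assms unfolding smooth_halfline_def by blast
  have at: "(D n has_real_derivative D (Suc n) r) (at r)" if "r > 0" for n r
  proof -
    have "at r within {0..} = at r"
      by (rule at_within_interior) (use that in simp)
    then show ?thesis using D[of r n] that by simp
  qed
  have F: "(F has_real_derivative D 1 r) (at r)" if "r > 0" for r
  proof (rule has_field_derivative_transform_within_open)
    show "(D 0 has_real_derivative D 1 r) (at r)" using at[OF that, of 0] by simp
  qed (use that D0 in \<open>auto intro: open_greaterThan\<close>)
  have c: "continuous_on {0..} (D n)" for n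
    by (rule DERIV_continuous_on) (use D in auto)
  show thesis
  proof (rule that[of "D 1" "D 2"])
    have "continuous_on {0<..} (D 2)" by (rule continuous_on_subset[OF c]) auto
    then show "C2_on {0<..} F (D 1) (D 2)"
      unfolding C2_on_def using F at[of _ 1] by (auto simp: numeral_2_eq_2)
    show "continuous_on {0..} F"
      using c[of 0] by (rule continuous_on_eq) (use D0 in auto)
    show "deriv F r = D 1 r" if "r > 0" for r using F[OF that] by (rule DERIV_imp_deriv)
  qed
qed

lemma C2_on_reflect:
  assumes "C2_on {0<..} F F' F''"
  shows "C2_on {..<0} (\<lambda>r. - F (- r)) (\<lambda>r. F' (- r)) (\<lambda>r. - F'' (- r))"
proof -
  have F: "(F has_real_derivative F' r) (at r)" "(F' has_real_derivative F'' r) (at r)" if "r > 0" for r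
    using assms that unfolding C2_on_def by auto
  have "continuous_on {..<0} (\<lambda>r. F'' (- r))"
    using assms unfolding C2_on_def
    by (intro continuous_on_compose2[where g = F'' and f = uminus and t = "{0<..}"] continuous_intros) auto
  moreover have "((\<lambda>r. - F (- r)) has_real_derivative F' (- r)) (at r)" if "r < 0" for r
    using DERIV_minus[OF DERIV_chain2[where f = F and g = uminus and x = r, OF F(1)
          DERIV_minus[OF DERIV_ident]]] that by simp
  moreover have "((\<lambda>r. F' (- r)) has_real_derivative - F'' (- r)) (at r)" if "r < 0" for r
    using DERIV_chain2[where f = F' and g = uminus and x = r, OF F(2)
          DERIV_minus[OF DERIV_ident]] that by simp
  ultimately show ?thesis unfolding C2_on_def by (auto intro: continuous_on_minus)
qed

lemma increments_bounded_reflect: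
  assumes "increments_bounded N L w"
  shows "increments_bounded N L (\<lambda>x. - w x)"
proof -
  have "\<bar>- w x - - w y\<bar> = \<bar>w x - w y\<bar>" "\<bar>- w x + - w y - 2 * - w z\<bar> = \<bar>w x + w y - 2 * w z\<bar>" for x y z
    by linarith+
  then show ?thesis using assms unfolding increments_bounded_def by presburger
qed

text \<open>Between consecutive zeros \<open>f\<close> keeps its sign, which is read off from \<open>f 0 > 0\<close> and the slopes at
  \<open>as\<close> and \<open>ap\<close>.\<close>
lemma bistable_signs:
  fixes f :: "real \<Rightarrow> real"
  assumes cont: "continuous_on {0..} f" and f0: "f 0 > 0"
    and ord: "0 < am" "am < as" "as < ap"
    and zeros: "{r. 0 \<le> r \<and> f r = 0} = {am, as, ap}"
    and das: "(f has_real_derivative das) (at as)" "das > 0"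
    and dap: "(f has_real_derivative dap) (at ap)" "dap < 0"
  shows "\<And>r. 0 \<le> r \<Longrightarrow> r < am \<Longrightarrow> 0 < f r" "\<And>r. am < r \<Longrightarrow> r < as \<Longrightarrow> f r < 0"
    "\<And>r. as < r \<Longrightarrow> r < ap \<Longrightarrow> 0 < f r" "\<And>r. ap < r \<Longrightarrow> f r < 0"
proof -
  have zero: "x = am \<or> x = as \<or> x = ap" if "0 \<le> x" "f x = 0" for x
    using zeros that by blast
  have c: "continuous_on {p..q} f" if "0 \<le> p" for p q
    by (rule continuous_on_subset[OF cont]) (use that in auto)
  have down: "\<exists>x. p \<le> x \<and> x \<le> q \<and> f x = 0" if "0 \<le> p" "p \<le> q" "f q \<le> 0" "0 \<le> f p" for p q
    using IVT2'[of f q 0 p] that c[of p q] by blast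
  have up: "\<exists>x. p \<le> x \<and> x \<le> q \<and> f x = 0" if "0 \<le> p" "p \<le> q" "f p \<le> 0" "0 \<le> f q" for p q
    using IVT'[of f p 0 q] that c[of p q] by blast
  have fz: "f as = 0" "f ap = 0" using zeros by auto
  show "0 < f r" if r: "0 \<le> r" "r < am" for r
  proof (rule ccontr)
    assume "\<not> 0 < f r"
    then obtain x where "0 \<le> x" "x \<le> r" "f x = 0" using down[of 0 r] r f0 by auto
    then show False using zero[of x] r ord by auto
  qed
  show "f r < 0" if r: "am < r" "r < as" for r
  proof (rule ccontr)
    assume neg: "\<not> f r < 0"
    obtain d where d: "d > 0" "\<And>h. h > 0 \<Longrightarrow> h < d \<Longrightarrow> f (as - h) < 0"
      using DERIV_pos_inc_left[OF das] fz by auto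
    define h where "h = min d (as - r) / 2"
    have h: "h > 0" "h < d" "r \<le> as - h" using d r by (auto simp: h_def min_def field_simps)
    then obtain x where "r \<le> x" "x \<le> as - h" "f x = 0"
      using down[of r "as - h"] d(2)[of h] neg r ord by auto
    then show False using zero[of x] r h ord by auto
  qed
  show "0 < f r" if r: "as < r" "r < ap" for r
  proof (rule ccontr)
    assume neg: "\<not> 0 < f r"
    obtain d where d: "d > 0" "\<And>h. h > 0 \<Longrightarrow> h < d \<Longrightarrow> 0 < f (as + h)"
      using DERIV_pos_inc_right[OF das] fz by auto
    define h where "h = min d (r - as) / 2"
    have h: "h > 0" "h < d" "as + h \<le> r" using d r by (auto simp: h_def min_def field_simps)
    then obtain x where "as + h \<le> x" "x \<le> r" "f x = 0"
      using down[of "as + h" r] d(2)[of h] neg r ord by auto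
    then show False using zero[of x] r h ord by auto
  qed
  show "f r < 0" if r: "ap < r" for r
  proof (rule ccontr)
    assume neg: "\<not> f r < 0"
    obtain d where d: "d > 0" "\<And>h. h > 0 \<Longrightarrow> h < d \<Longrightarrow> f (ap + h) < 0"
      using DERIV_neg_dec_right[OF dap] fz by auto
    define h where "h = min d (r - ap) / 2"
    have h: "h > 0" "h < d" "ap + h \<le> r" using d r by (auto simp: h_def min_def field_simps)
    then obtain x where "ap + h \<le> x" "x \<le> r" "f x = 0"
      using up[of "ap + h" r] d(2)[of h] neg r ord by auto
    then show False using zero[of x] r h ord by auto
  qed
qed

lemma sqrt_over_lattice_tendsto_0:
  fixes K :: "nat \<Rightarrow> real"
  assumes K: "K \<in> o(\<lambda>N. real N powr p)" and p: "p \<le> 1"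
  shows "(\<lambda>N. sqrt (K N) / real N) \<longlonglongrightarrow> 0"
proof (rule Lim_null_comparison)
  have "\<forall>\<^sub>F N in sequentially. norm (K N) \<le> 1 * norm (real N powr p)"
    using landau_o.smallD[OF K, of 1] by simp
  moreover have "\<forall>\<^sub>F N in sequentially. N \<ge> (1 :: nat)" by (rule eventually_ge_at_top)
  ultimately show "\<forall>\<^sub>F N in sequentially. norm (sqrt (K N) / real N) \<le> 1 / sqrt (real N)"
  proof eventually_elim
    case (elim N)
    have "real N powr p \<le> real N powr 1" using elim p by (intro powr_mono) auto
    then have "\<bar>K N\<bar> \<le> real N" using elim by simp
    then have "sqrt \<bar>K N\<bar> \<le> sqrt (real N)" by simp
    moreover have "\<bar>sqrt (K N)\<bar> = sqrt \<bar>K N\<bar>" by (simp add: abs_if real_sqrt_minus)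
    ultimately have "\<bar>sqrt (K N)\<bar> / real N \<le> sqrt (real N) / real N"
      by (intro divide_right_mono) auto
    also have "\<dots> = 1 / sqrt (real N)" using elim by (simp add: field_simps)
    finally show ?case by simp
  qed
  have "filterlim (\<lambda>N. sqrt (real N)) at_top sequentially"
    by (rule filterlim_compose[OF sqrt_at_top filterlim_real_sequentially])
  then show "(\<lambda>N. 1 / sqrt (real N)) \<longlonglongrightarrow> 0"
    by (intro tendsto_divide_0[OF tendsto_const] filterlim_at_top_imp_at_infinity)
qed

theorem theorem6p1:
  fixes g :: "nat \<Rightarrow> real"
    and cp cm :: "((int ^ 'd) \<Rightarrow> nat) \<Rightarrow> real"
    and \<phi> f :: "real \<Rightarrow> real"
    and am as ap um up \<theta> \<delta> \<gamma> \<gamma>b :: real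
    and u0 :: "real ^ 'd \<Rightarrow> real"
    and \<Gamma> Dp Dm :: "(real ^ 'd) set"
    and K :: "nat \<Rightarrow> real"
    and u :: "nat \<Rightarrow> real \<Rightarrow> int ^ 'd \<Rightarrow> real"
    and tN :: "nat \<Rightarrow> real"
  assumes dim: "CARD('d) \<ge> 2"
    \<comment> \<open>the functions \<open>\<phi>\<close> and \<open>f\<close>\<close>
    and g: "\<And>k. 0 \<le> g k" "\<And>k. g k = 0 \<longleftrightarrow> k = 0"
    and div: "mean_diverges g"
    and phi: "\<phi> = fugacity g"
    and c_local: "local_fun cp" "local_fun cm"
    and c_nonneg: "\<And>\<eta>. 0 \<le> cp \<eta>" "\<And>\<eta>. 0 \<le> cm \<eta>"
    and cm0: "\<And>\<eta>. \<eta> 0 = 0 \<Longrightarrow> cm \<eta> = 0"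
    and c_int: "\<And>\<rho>. 0 \<le> \<rho> \<Longrightarrow> integrable (nu g \<rho>) cp" "\<And>\<rho>. 0 \<le> \<rho> \<Longrightarrow> integrable (nu g \<rho>) cm"
    and f: "f = reaction g cp cm"
    and smooth: "smooth_halfline \<phi>" "smooth_halfline f"
    and phi_pos: "\<And>\<rho>. \<rho> > 0 \<Longrightarrow> deriv \<phi> \<rho> > 0"
    and f0: "f 0 > 0"
    \<comment> \<open>(BS)\<close>
    and alphas: "0 < am" "am < as" "as < ap"
    and zeros: "{\<rho>. 0 \<le> \<rho> \<and> f \<rho> = 0} = {am, as, ap}"
    and slopes: "deriv f am < 0" "deriv f as > 0" "deriv f ap < 0"
    and balance: "((\<lambda>\<rho>. f \<rho> * deriv \<phi> \<rho>) has_integral 0) {am..ap}"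
    \<comment> \<open>the solutions \<open>u\<^sup>N\<close>\<close>
    and sol: "\<And>N. N \<ge> 1 \<Longrightarrow> solves_disc N (K N) \<phi> f (u N)"
    \<comment> \<open>(BIP1)\<close>
    and bip1: "0 < um" "um < up" "\<And>N x. N \<ge> 1 \<Longrightarrow> um \<le> u N 0 x \<and> u N 0 x \<le> up"
    \<comment> \<open>(BIP2)\<close>
    and init: "\<And>N x. N \<ge> 1 \<Longrightarrow> u N 0 x = u0 (scaled N x)"
    and u0_reg: "torus_fun u0" "C_reg_on 5 UNIV u0"
    and Gam: "\<Gamma> = {v. u0 v = as}"
    and surf: "\<theta> > 0" "C_hypersurface (5 + \<theta>) \<Gamma>"
    and nondeg: "\<And>v n. v \<in> \<Gamma> \<Longrightarrow> unit_normal \<Gamma> v n \<Longrightarrow> frechet_derivative u0 (at v) n \<noteq> 0"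
    and regions: "open Dp" "open Dm" "torus_set Dp" "torus_set Dm" "Dp \<inter> Dm = {}" "Dp \<union> Dm = - \<Gamma>"
    and u0_Dp: "\<And>v. v \<in> Dp \<Longrightarrow> u0 v > as"
    and u0_Dm: "\<And>v. v \<in> Dm \<Longrightarrow> um < u0 v \<and> u0 v < as"
    \<comment> \<open>parameters and scaling\<close>
    and delta: "0 < \<delta>" "\<delta> < min (as - am) (ap - as)"
    and tN: "tN = (\<lambda>N. 1 / (2 * \<gamma> * K N) * ln (K N))"
    and gam: "\<gamma> = deriv f as"
    and gamb: "- \<gamma>b = (INF \<zeta>\<in>{min um am..max up ap}. deriv f \<zeta>)"
    and K: "mono K" "filterlim K at_top sequentially"
      "K \<in> o(\<lambda>N. real N powr (2 * \<gamma> / (3 * \<gamma> + \<gamma>b)))"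
  shows "\<exists>N0::nat. \<exists>M0::real. N0 > 0 \<and> M0 > 0 \<and> (\<forall>N\<ge>N0.
      (\<forall>x. am - \<delta> \<le> u N (tN N) x \<and> u N (tN N) x \<le> ap + \<delta>) \<and>
      (\<forall>x. u0 (scaled N x) \<ge> as + M0 * K N powr (-1/2) \<longrightarrow> u N (tN N) x \<ge> ap - \<delta>) \<and>
      (\<forall>x. u0 (scaled N x) \<le> as - M0 * K N powr (-1/2) \<longrightarrow> u N (tN N) x \<le> am + \<delta>))"
proof -
  obtain \<phi>' \<phi>'' where phi2: "C2_on {0<..} \<phi> \<phi>' \<phi>''" and phi_cont: "continuous_on {0..} \<phi>"
    and dphi: "\<And>r. r > 0 \<Longrightarrow> deriv \<phi> r = \<phi>' r"
    using smooth_halfline_C2[OF smooth(1)] by blast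
  obtain f' f'' where f2: "C2_on {0<..} f f' f''" and f_cont: "continuous_on {0..} f"
    and df: "\<And>r. r > 0 \<Longrightarrow> deriv f r = f' r"
    using smooth_halfline_C2[OF smooth(2)] by blast
  have Dphi: "(\<phi> has_real_derivative \<phi>' r) (at r)" if "r > 0" for r
    using phi2 that unfolding C2_on_def by simp
  have Df: "(f has_real_derivative f' r) (at r)" "(f' has_real_derivative f'' r) (at r)" if "r > 0" for r
    using f2 that unfolding C2_on_def by auto
  have mono0: "mono_on {0..} \<phi>"
  proof (rule mono_onI)
    fix r r' :: real assume r: "r \<in> {0..}" "r' \<in> {0..}" "r \<le> r'"
    show "\<phi> r \<le> \<phi> r'"
    proof (rule DERIV_nonneg_imp_increasing_open[OF r(3)])
      show "\<exists>y. (\<phi> has_real_derivative y) (at x) \<and> 0 \<le> y" if "r < x" "x < r'" for x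
        using Dphi[of x] phi_pos[of x] dphi[of x] that r by (intro exI[of _ "\<phi>' x"]) auto
      show "continuous_on {r..r'} \<phi>" by (rule continuous_on_subset[OF phi_cont]) (use r in auto)
    qed
  qed
  have as0: "0 < as" "0 < ap" using alphas by auto
  have \<gamma>: "f' as = \<gamma>" "\<gamma> > 0" using gam df[OF as0(1)] slopes(2) by auto
  have f_as: "f as = 0" using zeros by auto
  have dap: "f' ap < 0" using df[OF as0(2)] slopes(3) by simp
  have das: "f' as > 0" using \<gamma> by simp
  note signs = bistable_signs[OF f_cont f0 alphas zeros Df(1)[OF as0(1)] das Df(1)[OF as0(2)] dap]

  \<comment> \<open>The infimum of \<open>f'\<close> is taken over an interval that contains \<open>am\<close>, where the slope is negative.\<close>
  have \<gamma>b: "\<gamma>b > 0"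
  proof -
    let ?I = "{min um am..max up ap}"
    have I: "r > 0" if "r \<in> ?I" for r using that bip1 alphas by auto
    have "continuous_on ?I f'"
      by (rule DERIV_continuous_on, rule has_field_derivative_at_within, rule Df(2)) (use I in auto)
    then have "bounded (f' ` ?I)" by (auto intro!: compact_imp_bounded compact_continuous_image)
    moreover have "f' ` ?I = deriv f ` ?I" using I df by (auto simp: image_iff)
    ultimately have "bdd_below (deriv f ` ?I)" by (simp add: bounded_imp_bdd_below)
    then have "(INF \<zeta>\<in>?I. deriv f \<zeta>) \<le> deriv f am"
      by (rule cINF_lower) (use alphas in auto)
    then show ?thesis using gamb slopes(1) by linarith
  qed
  have "2 * \<gamma> / (3 * \<gamma> + \<gamma>b) \<le> 1" using \<gamma>(2) \<gamma>b by (simp add: divide_le_eq)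
  then have KN: "(\<lambda>N. sqrt (K N) / real N) \<longlonglongrightarrow> 0"
    by (rule sqrt_over_lattice_tendsto_0[OF K(3)])

  \<comment> \<open>Three orders of differentiability make the second partial derivatives continuous.\<close>
  have "C_reg_on 5 = (Ck_holder_on (Suc (Suc (Suc 2))) 0 :: (real ^ 'd) set \<Rightarrow> (real ^ 'd \<Rightarrow> real) \<Rightarrow> bool)"
    by (simp add: C_reg_on_def numeral_eq_Suc)
  then have "Ck_holder_on (Suc (Suc (Suc 2))) 0 UNIV u0" using u0_reg(2) by simp
  then obtain L where L: "L > 0" and inc0: "\<And>N. increments_bounded N L (\<lambda>x. u0 (scaled N x))"
    using sampled_increments_bounded[OF u0_reg(1)] by blast
  have sol': "solves_lattice N (K N) \<phi> f (u N)" and nonneg: "\<And>t x. 0 \<le> t \<Longrightarrow> 0 \<le> u N t x"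
    and inc: "increments_bounded N L (u N 0)" if "N \<ge> 1" for N
  proof -
    show "solves_lattice N (K N) \<phi> f (u N)" "\<And>t x. 0 \<le> t \<Longrightarrow> 0 \<le> u N t x"
      using sol[OF that] unfolding solves_disc_def solves_lattice_def by auto
    have "u N 0 = (\<lambda>x. u0 (scaled N x))" using init[OF that] by auto
    then show "increments_bounded N L (u N 0)" using inc0 by simp
  qed

  \<comment> \<open>Since \<open>am - \<delta>\<close> may be negative, the target \<open>b\<close> of the lower barrier is kept positive.\<close>
  define b where "b = am - min \<delta> am / 2"
  have b: "0 < b" "b < am" "am - \<delta> \<le> b - \<delta> / 2" using alphas delta by (auto simp: b_def min_def)
  define a where "a = min um b / 2"
  have a: "0 < a" "a < b" "a < um" using b bip1 by (auto simp: a_def min_def)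
  obtain c where c: "c > 0" "\<And>r. a \<le> r \<Longrightarrow> r \<le> b \<Longrightarrow> c * (b - r) < f r"
  proof (rule relaxation_rate[of a b f])
    show "continuous_on {a..b} f" by (rule continuous_on_subset[OF f_cont]) (use a in auto)
    show "0 < f r" if "a \<le> r" "r \<le> b" for r using signs(1)[of r] that a b by simp
  qed (use a in auto)
  have large: "\<forall>\<^sub>F N in sequentially. N \<ge> (1 :: nat) \<and> K N > 0"
    using eventually_ge_at_top[of 1] filterlim_at_top_dense[THEN iffD1, OF K(2), rule_format, of 0]
    by eventually_elim auto
  then have pos: "\<forall>\<^sub>F N in sequentially. N \<ge> 1 \<and> (\<forall>t\<ge>0. \<forall>x. 0 < u N t x)"
  proof eventually_elim
    case (elim N)
    have "0 < u N t x" if t: "0 \<le> t" for t x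
    proof -
      have "b - (b - a) * exp (- c * K N * t) < u N t x"
        by (rule constant_barrier[OF _ sol' _ mono0 a(2) _ _ c _ t])
           (use elim nonneg bip1(3) a in \<open>auto intro: less_le_trans\<close>)
      then show ?thesis using barrier_ge_start[OF _ c(1) _ t, of a b "K N"] a elim by simp
    qed
    then show ?case using elim by simp
  qed

  have low: "\<exists>M>0. \<forall>\<^sub>F N in sequentially. \<forall>x.
     b - \<delta> / 2 \<le> u N (1 / (2 * \<gamma> * K N) * ln (K N)) x \<and>
     (as + M * K N powr (-1/2) \<le> u N 0 x \<longrightarrow>
        as + (ap - as - \<delta> / 2) - \<delta> / 2 \<le> u N (1 / (2 * \<gamma> * K N) * ln (K N)) x)"
  proof (rule interface_generation_lower[where J = "{0<..}" and a' = "a / 2" and a = a])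
    show "C2_on {0<..} \<phi> \<phi>' \<phi>''" "C2_on {0<..} f f' f''" by (fact phi2 f2)+
    show "mono_on {0<..} \<phi>" by (rule mono_on_subset[OF mono0]) auto
    show "\<forall>\<^sub>F N in sequentially. solves_lattice N (K N) \<phi> f (u N) \<and>
      (\<forall>t\<ge>0. \<forall>x. u N t x \<in> {0<..}) \<and> (\<forall>x. a < u N 0 x) \<and> increments_bounded N L (u N 0)"
      using pos by eventually_elim (use sol' inc bip1(3) a in \<open>auto intro: less_le_trans\<close>)
    show "0 < f r" if "as < r" "r \<le> as + (ap - as - \<delta> / 2)" for r
      using signs(3)[of r] that delta by simp
    show "0 < f r" if "a \<le> r" "r \<le> b" for r using signs(1)[of r] that a b by simp
  qed (use a b alphas delta f_as \<gamma> K(2) KN L in auto)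

  have up: "\<exists>M>0. \<forall>\<^sub>F N in sequentially. \<forall>x.
     - (ap + \<delta> / 2) - \<delta> / 2 \<le> - u N (1 / (2 * \<gamma> * K N) * ln (K N)) x \<and>
     (- as + M * K N powr (-1/2) \<le> - u N 0 x \<longrightarrow>
        - as + (as - am - \<delta> / 2) - \<delta> / 2 \<le> - u N (1 / (2 * \<gamma> * K N) * ln (K N)) x)"
  proof (rule interface_generation_lower[where J = "{..<0}" and a' = "- max up (ap + \<delta>) - 2"
        and a = "- max up (ap + \<delta>) - 1" and u = "\<lambda>N t x. - u N t x"])
    show "mono_on {..<0} (\<lambda>r. - \<phi> (- r))"
      by (rule mono_onI) (auto intro!: mono_onD[OF mono0])
    show "C2_on {..<0} (\<lambda>r. - \<phi> (- r)) (\<lambda>r. \<phi>' (- r)) (\<lambda>r. - \<phi>'' (- r))"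
      by (rule C2_on_reflect[OF phi2])
    show "C2_on {..<0} (\<lambda>r. - f (- r)) (\<lambda>r. f' (- r)) (\<lambda>r. - f'' (- r))"
      by (rule C2_on_reflect[OF f2])
    show "\<forall>\<^sub>F N in sequentially. solves_lattice N (K N) (\<lambda>r. - \<phi> (- r)) (\<lambda>r. - f (- r)) (\<lambda>t x. - u N t x) \<and>
      (\<forall>t\<ge>0. \<forall>x. - u N t x \<in> {..<0}) \<and> (\<forall>x. - max up (ap + \<delta>) - 1 < - u N 0 x) \<and>
      increments_bounded N L (\<lambda>x. - u N 0 x)"
      using pos
    proof eventually_elim
      case (elim N)
      have "- max up (ap + \<delta>) - 1 < - u N 0 x" for x using bip1(3)[of N x] elim by auto
      then show ?case
        using elim solves_lattice_reflect[OF sol'] increments_bounded_reflect[OF inc] by auto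
    qed
    show "0 < - f (- r)" if "- as < r" "r \<le> - as + (as - am - \<delta> / 2)" for r
      using signs(2)[of "- r"] that delta by simp
    show "0 < - f (- r)" if "- max up (ap + \<delta>) - 1 \<le> r" "r \<le> - (ap + \<delta> / 2)" for r
      using signs(4)[of "- r"] that delta by simp
  qed (use alphas delta f_as \<gamma> K(2) KN L in auto)

  obtain M1 where M1: "M1 > 0" "\<forall>\<^sub>F N in sequentially. \<forall>x.
     b - \<delta> / 2 \<le> u N (tN N) x \<and>
     (as + M1 * K N powr (-1/2) \<le> u N 0 x \<longrightarrow> as + (ap - as - \<delta> / 2) - \<delta> / 2 \<le> u N (tN N) x)"
    using low unfolding tN by blast
  obtain M2 where M2: "M2 > 0" "\<forall>\<^sub>F N in sequentially. \<forall>x.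
     - (ap + \<delta> / 2) - \<delta> / 2 \<le> - u N (tN N) x \<and>
     (- as + M2 * K N powr (-1/2) \<le> - u N 0 x \<longrightarrow> - as + (as - am - \<delta> / 2) - \<delta> / 2 \<le> - u N (tN N) x)"
    using up unfolding tN by blast
  define M where "M = max M1 M2"
  have M: "M > 0" using M1 by (simp add: M_def)
  have "\<forall>\<^sub>F N in sequentially.
      (\<forall>x. am - \<delta> \<le> u N (tN N) x \<and> u N (tN N) x \<le> ap + \<delta>) \<and>
      (\<forall>x. u0 (scaled N x) \<ge> as + M * K N powr (-1/2) \<longrightarrow> u N (tN N) x \<ge> ap - \<delta>) \<and>
      (\<forall>x. u0 (scaled N x) \<le> as - M * K N powr (-1/2) \<longrightarrow> u N (tN N) x \<le> am + \<delta>)"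
    using M1(2) M2(2) eventually_ge_at_top[of "1 :: nat"]
  proof eventually_elim
    case (elim N)
    have MK: "M1 * K N powr (-1/2) \<le> M * K N powr (-1/2)" "M2 * K N powr (-1/2) \<le> M * K N powr (-1/2)"
      by (auto simp: M_def intro!: mult_right_mono)
    show ?case
    proof (intro conjI allI impI)
      fix x
      note l = elim(1)[rule_format, of x] and h = elim(2)[rule_format, of x]
      show "am - \<delta> \<le> u N (tN N) x" using l b by linarith
      show "u N (tN N) x \<le> ap + \<delta>" using h by linarith
      show "ap - \<delta> \<le> u N (tN N) x" if "as + M * K N powr (-1/2) \<le> u0 (scaled N x)"
        using l that MK init[OF elim(3), of x] by linarith
      show "u N (tN N) x \<le> am + \<delta>" if "u0 (scaled N x) \<le> as - M * K N powr (-1/2)"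
        using h that MK init[OF elim(3), of x] by linarith
    qed
  qed
  then obtain N0 where N0: "\<forall>N\<ge>N0.
      (\<forall>x. am - \<delta> \<le> u N (tN N) x \<and> u N (tN N) x \<le> ap + \<delta>) \<and>
      (\<forall>x. u0 (scaled N x) \<ge> as + M * K N powr (-1/2) \<longrightarrow> u N (tN N) x \<ge> ap - \<delta>) \<and>
      (\<forall>x. u0 (scaled N x) \<le> as - M * K N powr (-1/2) \<longrightarrow> u N (tN N) x \<le> am + \<delta>)"
    unfolding eventually_sequentially by blast
  show ?thesis
    by (rule exI[of _ "max N0 1"], rule exI[of _ M]) (use N0 M in simp)
qed

end
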